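(* There is a constant $\gamma>0$ and an absolute constant $c>0$ such that the following holds. Given a stream of $n$ i.i.d. uniformly random bits in $\{-1,1\}$, any $k$-pass streaming algorithm which outputs the majority of these bits with probability at least $1-\gamma$ must use at least $c\frac{\log n}{k}$ bits of memory.
   Context: A $k$-pass streaming algorithm reads the stream in order $k$ times, may use private randomness, and has a bounded number of bits of memory (its state between steps). Success probability is over the input and the algorithm's randomness. *)

theory Defs
  imports "HOL-Probability.Probability"
begin

text \<open>A k-pass streaming algorithm with s bits of memory over a stream of n bits in {-1,1}.
  Private randomness: a random seed (rho :: nat) drawn from an arbitrary discrete distribution R.
  Memory states are the naturals below 2^s.  The algorithm consists of
  an initial state init rho, a transition function delta rho j i st x
  (pass j, position i, current state st, current bit x), and an output
  function out rho st applied to the state after the last pass.\<close>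

fun run_pass :: "(nat \<Rightarrow> nat \<Rightarrow> nat \<Rightarrow> nat \<Rightarrow> int \<Rightarrow> nat) \<Rightarrow> nat \<Rightarrow> nat \<Rightarrow> nat \<Rightarrow> nat \<Rightarrow> int list \<Rightarrow> nat"
where
  "run_pass \<delta> \<rho> j i st [] = st"
| "run_pass \<delta> \<rho> j i st (x # xs) = run_pass \<delta> \<rho> j (Suc i) (\<delta> \<rho> j i st x) xs"

fun run_passes :: "(nat \<Rightarrow> nat \<Rightarrow> nat \<Rightarrow> nat \<Rightarrow> int \<Rightarrow> nat) \<Rightarrow> nat \<Rightarrow> nat \<Rightarrow> nat \<Rightarrow> int list \<Rightarrow> nat"
where
  "run_passes \<delta> \<rho> 0 st xs = st"
| "run_passes \<delta> \<rho> (Suc m) st xs = run_pass \<delta> \<rho> m 0 (run_passes \<delta> \<rho> m st xs) xs"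

definition streams :: "nat \<Rightarrow> int list set" where
  "streams n = {xs. length xs = n \<and> set xs \<subseteq> {-1, 1}}"

definition majority :: "int list \<Rightarrow> int" where
  "majority xs = (if sum_list xs \<ge> 0 then 1 else -1)"

definition success_prob ::
  "nat pmf \<Rightarrow> (nat \<Rightarrow> nat) \<Rightarrow> (nat \<Rightarrow> nat \<Rightarrow> nat \<Rightarrow> nat \<Rightarrow> int \<Rightarrow> nat) \<Rightarrow> (nat \<Rightarrow> nat \<Rightarrow> int) \<Rightarrow> nat \<Rightarrow> nat \<Rightarrow> real"
where
  "success_prob R init \<delta> out k n =
     measure_pmf.prob (pair_pmf R (pmf_of_set (streams n)))
       {(\<rho>, xs). out \<rho> (run_passes \<delta> \<rho> k (init \<rho>) xs) = majority xs}"

definition memory_bounded ::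
  "(nat \<Rightarrow> nat) \<Rightarrow> (nat \<Rightarrow> nat \<Rightarrow> nat \<Rightarrow> nat \<Rightarrow> int \<Rightarrow> nat) \<Rightarrow> nat \<Rightarrow> nat \<Rightarrow> nat \<Rightarrow> bool"
where
  "memory_bounded init \<delta> s k n \<longleftrightarrow>
     (\<forall>\<rho>. init \<rho> < 2 ^ s) \<and>
     (\<forall>\<rho> j i st x. j < k \<longrightarrow> i < n \<longrightarrow> st < 2 ^ s \<longrightarrow> x \<in> {-1, 1} \<longrightarrow> \<delta> \<rho> j i st x < 2 ^ s)"

end

theory Submission
  imports Defs
begin

text \<open>Fix the seed. Let \<open>\<tau>\<close> be the tuple of states at the ends of the passes and \<open>Z i\<close> the pair of \<open>\<tau>\<close> and
  the tuple of states of all passes after \<open>i\<close> bits; both take at most \<open>2 ^ (2 * s * k)\<close> values. Given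
  \<open>Z i\<close>, the first \<open>i\<close> bits are independent of the others. Given \<open>\<tau>\<close>, write each bit \<open>X j\<close> as a
  predictable drift \<open>b j\<close> plus a martingale difference \<open>\<xi> j\<close>. A correct answer is a function of \<open>\<tau>\<close>, so
  \<open>\<tau>\<close> explains a constant fraction of the variance of the sum of the bits. As the sum of the \<open>\<xi> j\<close> has
  almost full variance and mean zero given \<open>\<tau>\<close>, the later bits must anticorrelate with it: the sum
  over \<open>j\<close> of \<open>E (\<xi> j * (X (j + 1) + \<dots> + X (n - 1)))\<close> is at most a negative constant times \<open>n\<close>.

  The bits after \<open>j + d\<close> are correlated with \<open>\<xi> j\<close> only through \<open>Z (j + d)\<close>. Since \<open>Z i\<close> carries at most
  \<open>2 * s * k\<close> bits of information, summing the squared bias of \<open>X j\<close> given the first \<open>j\<close> bits and \<open>Z (j + d)\<close>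
  over all \<open>j\<close> gives numbers \<open>\<epsilon> d\<close> whose sum over \<open>d\<close> is \<open>O (n * s * k)\<close>. If \<open>s * k\<close> is much smaller
  than \<open>ln n\<close>, the divergence of the harmonic series yields a small \<open>d\<close> with \<open>d * \<epsilon> d\<close> much smaller than \<open>n\<close>.
  The expected future changes by \<open>O (sqrt d)\<close> in mean square over a window of length \<open>d\<close>, so Cauchy--Schwarz
  bounds the correlation by a small multiple of \<open>n\<close>, a contradiction.\<close>

section \<open>Averages over the fibres of a map\<close>

text \<open>The conditional expectation of \<open>\<phi>\<close> given \<open>\<kappa>\<close> under
  the uniform distribution on \<open>A\<close>.\<close>

definition fibre_avg :: "'a set \<Rightarrow> ('a \<Rightarrow> 'b) \<Rightarrow> ('a \<Rightarrow> real) \<Rightarrow> 'a \<Rightarrow> real" where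
  "fibre_avg A \<kappa> \<phi> x = (\<Sum>y\<in>{y\<in>A. \<kappa> y = \<kappa> x}. \<phi> y) / real (card {y\<in>A. \<kappa> y = \<kappa> x})"

text \<open>Measurability with respect to \<open>\<kappa>\<close> on the finite space
  \<open>A\<close>.\<close>

definition factors_on :: "'a set \<Rightarrow> ('a \<Rightarrow> 'b) \<Rightarrow> ('a \<Rightarrow> 'c) \<Rightarrow> bool" where
  "factors_on A \<kappa> \<psi> \<longleftrightarrow> (\<forall>x\<in>A. \<forall>y\<in>A. \<kappa> x = \<kappa> y \<longrightarrow> \<psi> x = \<psi> y)"

lemma factors_onI: "(\<And>x y. x \<in> A \<Longrightarrow> y \<in> A \<Longrightarrow> \<kappa> x = \<kappa> y \<Longrightarrow> \<psi> x = \<psi> y) \<Longrightarrow> factors_on A \<kappa> \<psi>"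
  unfolding factors_on_def by blast

lemma factors_onD: "factors_on A \<kappa> \<psi> \<Longrightarrow> x \<in> A \<Longrightarrow> y \<in> A \<Longrightarrow> \<kappa> x = \<kappa> y \<Longrightarrow> \<psi> x = \<psi> y"
  unfolding factors_on_def by blast

lemma factors_on_trans: "factors_on A \<kappa> \<mu> \<Longrightarrow> factors_on A \<mu> \<psi> \<Longrightarrow> factors_on A \<kappa> \<psi>"
  unfolding factors_on_def by blast

lemma factors_on_comp: "factors_on A \<kappa> \<psi> \<Longrightarrow> factors_on A \<kappa> (\<lambda>x. f (\<psi> x))"
  unfolding factors_on_def by metis

lemma factors_on_comp2:
  "factors_on A \<kappa> \<psi> \<Longrightarrow> factors_on A \<kappa> \<phi> \<Longrightarrow> factors_on A \<kappa> (\<lambda>x. f (\<psi> x) (\<phi> x))"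
  unfolding factors_on_def by metis

lemma factors_on_sum:
  fixes \<psi> :: "'i \<Rightarrow> 'a \<Rightarrow> 'c::comm_monoid_add"
  shows "(\<And>i. i \<in> I \<Longrightarrow> factors_on A \<kappa> (\<psi> i)) \<Longrightarrow> factors_on A \<kappa> (\<lambda>x. \<Sum>i\<in>I. \<psi> i x)"
  by (rule factors_onI, rule sum.cong) (auto dest: factors_onD)

lemma factors_on_fibre_avg: "factors_on A \<kappa> (fibre_avg A \<kappa> \<phi>)"
  by (rule factors_onI) (simp add: fibre_avg_def)

lemma fibre_avg_add: "fibre_avg A \<kappa> (\<lambda>x. \<phi> x + \<psi> x) x = fibre_avg A \<kappa> \<phi> x + fibre_avg A \<kappa> \<psi> x"
  by (simp add: fibre_avg_def sum.distrib add_divide_distrib)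

lemma fibre_avg_ident:
  assumes "finite A" "x \<in> A" "factors_on A \<kappa> \<psi>"
  shows "fibre_avg A \<kappa> \<psi> x = \<psi> x"
proof -
  let ?C = "{y\<in>A. \<kappa> y = \<kappa> x}"
  have "(\<Sum>y\<in>?C. \<psi> y) = (\<Sum>y\<in>?C. \<psi> x)"
    using assms by (intro sum.cong) (auto dest: factors_onD)
  moreover have "card ?C > 0" using assms by (auto simp: card_gt_0_iff)
  ultimately show ?thesis by (simp add: fibre_avg_def)
qed

text \<open>On a fibre \<open>\<psi>\<close> is constant, and averaging preserves the sum of
  \<open>\<phi>\<close> there. So a conditional expectation can be inserted or removed beside any
  factor that \<open>\<kappa>\<close> determines.\<close>

lemma sum_mult_fibre_avg:
  assumes fin: "finite A" and m: "factors_on A \<kappa> \<psi>"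
  shows "(\<Sum>x\<in>A. \<psi> x * fibre_avg A \<kappa> \<phi> x) = (\<Sum>x\<in>A. \<psi> x * \<phi> x)"
proof -
  have one: "(\<Sum>x\<in>{x\<in>A. \<kappa> x = k}. \<psi> x * fibre_avg A \<kappa> \<phi> x) = (\<Sum>x\<in>{x\<in>A. \<kappa> x = k}. \<psi> x * \<phi> x)"
    if k: "k \<in> \<kappa> ` A" for k
  proof -
    let ?C = "{x\<in>A. \<kappa> x = k}"
    from k obtain z where z: "z \<in> A" "\<kappa> z = k" by auto
    have c0: "card ?C > 0" using fin z by (auto simp: card_gt_0_iff)
    have psi: "\<psi> x = \<psi> z" if "x \<in> ?C" for x using m that z by (auto dest: factors_onD)
    have avg: "fibre_avg A \<kappa> \<phi> x = (\<Sum>y\<in>?C. \<phi> y) / real (card ?C)" if "x \<in> ?C" for x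
      using that by (simp add: fibre_avg_def)
    have "(\<Sum>x\<in>?C. \<psi> x * fibre_avg A \<kappa> \<phi> x) = (\<Sum>x\<in>?C. \<psi> z * ((\<Sum>y\<in>?C. \<phi> y) / real (card ?C)))"
      using psi avg by (intro sum.cong) auto
    also have "\<dots> = \<psi> z * (\<Sum>y\<in>?C. \<phi> y)" using c0 by simp
    also have "\<dots> = (\<Sum>x\<in>?C. \<psi> x * \<phi> x)"
      using psi by (simp add: sum_distrib_left)
    finally show ?thesis .
  qed
  show ?thesis
    by (subst (1 2) sum.image_gen[OF fin, of _ \<kappa>]) (rule sum.cong[OF refl one])
qed

text \<open>Conditional expectation is an orthogonal projection, hence a contraction in mean
  square.\<close>

lemma fibre_avg_power2_le:
  assumes "finite A"
  shows "(\<Sum>x\<in>A. (fibre_avg A \<kappa> \<phi> x)\<^sup>2) \<le> (\<Sum>x\<in>A. (\<phi> x)\<^sup>2)"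
proof -
  let ?a = "fibre_avg A \<kappa> \<phi>"
  have "(\<Sum>x\<in>A. (?a x)\<^sup>2) = (\<Sum>x\<in>A. ?a x * \<phi> x)"
    using sum_mult_fibre_avg[OF assms factors_on_fibre_avg, of \<kappa> \<phi> \<phi>] by (simp add: power2_eq_square)
  moreover have "0 \<le> (\<Sum>x\<in>A. (\<phi> x - ?a x)\<^sup>2)" by (intro sum_nonneg) auto
  ultimately show ?thesis
    by (simp add: power2_diff sum.distrib sum_subtractf mult.assoc mult.commute[of "\<phi> _"]
        flip: sum_distrib_left)
qed

text \<open>Every fibre contributes exactly one. This takes the place of Jensen's inequality in the
  entropy bound below.\<close>

lemma sum_inverse_card_fibre:
  assumes "finite A"
  shows "(\<Sum>x\<in>A. 1 / real (card {y\<in>A. \<kappa> y = \<kappa> x})) = real (card (\<kappa> ` A))"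
proof -
  have "(\<Sum>x\<in>{x\<in>A. \<kappa> x = k}. 1 / real (card {y\<in>A. \<kappa> y = \<kappa> x})) = 1" if "k \<in> \<kappa> ` A" for k
  proof -
    have "card {x\<in>A. \<kappa> x = k} > 0" using that assms by (auto simp: card_gt_0_iff)
    moreover have "(\<Sum>x\<in>{x\<in>A. \<kappa> x = k}. 1 / real (card {y\<in>A. \<kappa> y = \<kappa> x}))
        = (\<Sum>x\<in>{x\<in>A. \<kappa> x = k}. 1 / real (card {y\<in>A. \<kappa> y = k}))"
      by (rule sum.cong) auto
    ultimately show ?thesis by simp
  qed
  then show ?thesis by (subst sum.image_gen[OF assms, of _ \<kappa>]) simp
qed

section \<open>Uniform sign sequences\<close>

lemma streams_Suc: "streams (Suc n) = (#) 1 ` streams n \<union> (#) (-1) ` streams n"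
proof
  show "streams (Suc n) \<subseteq> (#) 1 ` streams n \<union> (#) (-1) ` streams n"
  proof
    fix x assume "x \<in> streams (Suc n)"
    then show "x \<in> (#) 1 ` streams n \<union> (#) (-1) ` streams n"
      by (cases x) (auto simp: streams_def)
  qed
qed (auto simp: streams_def)

lemma finite_streams [simp]: "finite (streams n)"
  by (induction n) (auto simp: streams_Suc, simp add: streams_def)

lemma sum_streams_Suc:
  "(\<Sum>x\<in>streams (Suc n). g x) = (\<Sum>x\<in>streams n. g (1 # x) + g ((-1) # x) :: real)"
proof -
  have "(\<Sum>x\<in>streams (Suc n). g x) = (\<Sum>x\<in>(#) 1 ` streams n. g x) + (\<Sum>x\<in>(#) (-1) ` streams n. g x)"
    unfolding streams_Suc by (rule sum.union_disjoint) auto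
  then show ?thesis by (simp add: sum.reindex sum.distrib)
qed

lemma streams_0 [simp]: "streams 0 = {[]}"
  by (auto simp: streams_def)

lemma card_streams: "real (card (streams n)) = 2 ^ n"
proof -
  have "(\<Sum>x\<in>streams n. 1::real) = 2 ^ n"
    by (induction n) (simp_all only: sum_streams_Suc streams_0, simp_all add: mult.commute)
  then show ?thesis by simp
qed

lemma streams_append:
  "x \<in> streams n \<Longrightarrow> y \<in> streams n \<Longrightarrow> take i x @ drop i y \<in> streams n"
  unfolding streams_def
  by (auto dest: in_set_takeD in_set_dropD simp: min_def)

abbreviation (input) coord :: "nat \<Rightarrow> int list \<Rightarrow> real" where
  "coord j x \<equiv> real_of_int (x ! j)"

lemma coord_cases: "x \<in> streams n \<Longrightarrow> j < n \<Longrightarrow> coord j x = 1 \<or> coord j x = -1"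
  using nth_mem[of j x] unfolding streams_def by fastforce

lemma coord_power2: "x \<in> streams n \<Longrightarrow> j < n \<Longrightarrow> (coord j x)\<^sup>2 = 1"
  using coord_cases[of x n j] by auto

lemma sum_list_coords: "x \<in> streams n \<Longrightarrow> real_of_int (sum_list x) = (\<Sum>j<n. coord j x)"
  by (simp add: sum_list_sum_nth streams_def lessThan_atLeast0)

lemma second_moment_streams:
  "(\<Sum>x\<in>streams n. (real_of_int (sum_list x))\<^sup>2) = real n * 2 ^ n"
proof (induction n)
  case (Suc n)
  have "(\<Sum>x\<in>streams (Suc n). (real_of_int (sum_list x))\<^sup>2)
     = (\<Sum>x\<in>streams n. 2 * (real_of_int (sum_list x))\<^sup>2 + 2)"
    unfolding sum_streams_Suc by (intro sum.cong) (auto simp: power2_eq_square algebra_simps)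
  also have "\<dots> = 2 * (real n * 2 ^ n) + 2 * 2 ^ n"
    by (simp add: sum.distrib sum_distrib_left[symmetric] Suc card_streams)
  finally show ?case by (simp add: algebra_simps)
qed simp

text \<open>In \<open>(t + 1)^4 + (t - 1)^4\<close> the odd powers cancel, which leaves a recursion
  involving only the second and fourth moments.\<close>

lemma fourth_moment_streams:
  "(\<Sum>x\<in>streams n. (real_of_int (sum_list x)) ^ 4) \<le> 3 * (real n)\<^sup>2 * 2 ^ n"
proof (induction n)
  case (Suc n)
  have "(\<Sum>x\<in>streams (Suc n). (real_of_int (sum_list x)) ^ 4)
     = (\<Sum>x\<in>streams n. 2 * (real_of_int (sum_list x)) ^ 4 + 12 * (real_of_int (sum_list x))\<^sup>2 + 2)"
    unfolding sum_streams_Suc by (intro sum.cong) (auto simp: power2_eq_square power4_eq_xxxx algebra_simps)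
  also have "\<dots> = 2 * (\<Sum>x\<in>streams n. (real_of_int (sum_list x)) ^ 4) + 12 * (real n * 2 ^ n) + 2 * 2 ^ n"
    by (simp add: sum.distrib sum_distrib_left[symmetric] second_moment_streams card_streams)
  also have "\<dots> \<le> 2 * (3 * (real n)\<^sup>2 * 2 ^ n) + 12 * (real n * 2 ^ n) + 2 * 2 ^ n"
    using Suc by (intro add_mono mult_left_mono) auto
  also have "\<dots> \<le> 3 * (real (Suc n))\<^sup>2 * 2 ^ Suc n"
    by (simp add: power2_eq_square algebra_simps)
  finally show ?case .
qed simp

text \<open>The first absolute moment is bounded below by the second and fourth moments through a
  polynomial minorant of \<open>t\<close>. It touches \<open>t\<close> at \<open>3/2\<close>; at
  scale \<open>sqrt n\<close> it gives \<open>1 - 3 * 4/27 = 5/9\<close>. Being above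
  \<open>1/2\<close>, this leaves room for the errors of an algorithm.\<close>

lemma first_abs_moment_streams:
  assumes "n \<ge> 1"
  shows "(\<Sum>x\<in>streams n. \<bar>real_of_int (sum_list x)\<bar>) \<ge> 5 / 9 * sqrt n * 2 ^ n"
proof -
  define r where "r = sqrt n"
  have r: "r > 0" "r\<^sup>2 = real n" using assms by (auto simp: r_def)
  have r4: "r ^ 4 = (real n)\<^sup>2" using r(2) by (metis power2_eq_square power4_eq_xxxx mult.assoc)
  have pt: "t \<ge> t\<^sup>2 - 4 / 27 * t ^ 4" if "t \<ge> 0" for t :: real
  proof -
    have "t - (t\<^sup>2 - 4 / 27 * t ^ 4) = t * ((1 - 2 * t / 3)\<^sup>2 * (1 + t / 3))"
      by (simp add: power2_eq_square power4_eq_xxxx field_simps)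
    also have "\<dots> \<ge> 0" using that by (intro mult_nonneg_nonneg) auto
    finally show ?thesis by simp
  qed
  have "r * ((real n * 2 ^ n) / r\<^sup>2 - 4 / 27 * ((3 * (real n)\<^sup>2 * 2 ^ n) / r ^ 4))
      \<le> r * ((\<Sum>x\<in>streams n. (real_of_int (sum_list x))\<^sup>2) / r\<^sup>2
          - 4 / 27 * ((\<Sum>x\<in>streams n. (real_of_int (sum_list x)) ^ 4) / r ^ 4))"
    using r fourth_moment_streams[of n]
    by (intro mult_left_mono diff_mono divide_right_mono) (auto simp: second_moment_streams)
  also have "\<dots> = (\<Sum>x\<in>streams n. r * ((\<bar>real_of_int (sum_list x)\<bar> / r)\<^sup>2
          - 4 / 27 * (\<bar>real_of_int (sum_list x)\<bar> / r) ^ 4))"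
    by (simp only: power_divide power2_abs power_even_abs_numeral even_numeral
        sum_distrib_left sum_subtractf sum_divide_distrib right_diff_distrib)
  also have "\<dots> \<le> (\<Sum>x\<in>streams n. r * (\<bar>real_of_int (sum_list x)\<bar> / r))"
    using r pt by (intro sum_mono mult_left_mono) auto
  also have "\<dots> = (\<Sum>x\<in>streams n. \<bar>real_of_int (sum_list x)\<bar>)" using r by simp
  finally have "r * ((real n * 2 ^ n) / r\<^sup>2 - 4 / 27 * ((3 * (real n)\<^sup>2 * 2 ^ n) / r ^ 4))
     \<le> (\<Sum>x\<in>streams n. \<bar>real_of_int (sum_list x)\<bar>)" .
  moreover have "r * ((real n * 2 ^ n) / r\<^sup>2 - 4 / 27 * ((3 * (real n)\<^sup>2 * 2 ^ n) / r ^ 4)) = 5 / 9 * r * 2 ^ n"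
    using assms unfolding r(2) r4 by (simp add: field_simps)
  ultimately show ?thesis by (simp only: r_def)
qed

section \<open>Bits predicted by a function with few values\<close>

text \<open>The left side is twice the relative entropy, from a fair sign, of a sign with mean
  \<open>e\<close>. The difference \<open>G\<close> of the two sides has derivative
  \<open>g\<close>, which is itself nondecreasing from 0. The endpoint is separate because
  \<open>ln (1 - t)\<close> is not differentiable there.\<close>

lemma binary_pinsker_nonneg:
  fixes e :: real
  assumes "0 \<le> e" "e \<le> 1"
  shows "(1 + e) * ln (1 + e) + (1 - e) * ln (1 - e) \<ge> e\<^sup>2"
proof (cases "e = 1")
  case True
  then show ?thesis using ln2_ge_two_thirds by simp
next
  case False
  define g where "g = (\<lambda>t::real. ln (1 + t) - ln (1 - t) - 2 * t)"
  define G where "G = (\<lambda>t::real. (1 + t) * ln (1 + t) + (1 - t) * ln (1 - t) - t\<^sup>2)"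
  have g_nonneg: "g t \<ge> 0" if "0 \<le> t" "t \<le> e" for t
  proof -
    have "g 0 \<le> g t"
    proof (rule DERIV_nonneg_imp_nondecreasing[OF that(1)])
      fix u assume u: "0 \<le> u" "u \<le> t"
      then have lt: "u < 1" using that False assms by linarith
      have "(g has_real_derivative (1 / (1 + u) + 1 / (1 - u) - 2)) (at u)"
        unfolding g_def using u lt by (auto intro!: derivative_eq_intros)
      moreover have "1 / (1 + u) + 1 / (1 - u) - 2 = 2 * u\<^sup>2 / ((1 + u) * (1 - u))"
        using u lt by (simp add: divide_simps power2_eq_square) (simp add: algebra_simps)
      moreover have "2 * u\<^sup>2 / ((1 + u) * (1 - u)) \<ge> 0" using u lt by simp
      ultimately show "\<exists>y. (g has_real_derivative y) (at u) \<and> 0 \<le> y" by auto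
    qed
    then show ?thesis by (simp add: g_def)
  qed
  have "G 0 \<le> G e"
  proof (rule DERIV_nonneg_imp_nondecreasing[OF assms(1)])
    fix u assume u: "0 \<le> u" "u \<le> e"
    then have lt: "u < 1" using False assms by linarith
    have "(G has_real_derivative g u) (at u)"
    proof -
      have "(G has_real_derivative ((1 * ln (1 + u) + 1 / (1 + u) * (1 + u))
          + ((- 1) * ln (1 - u) + (- 1) / (1 - u) * (1 - u)) - 2 * u)) (at u)"
        unfolding G_def using u lt by (auto intro!: derivative_eq_intros)
      then show ?thesis using u lt by (simp add: g_def)
    qed
    then show "\<exists>y. (G has_real_derivative y) (at u) \<and> 0 \<le> y" using g_nonneg[OF u] by auto
  qed
  then show ?thesis by (simp add: G_def)
qed

lemma binary_pinsker:
  fixes e :: real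
  assumes "\<bar>e\<bar> \<le> 1"
  shows "(1 + e) * ln (1 + e) + (1 - e) * ln (1 - e) \<ge> e\<^sup>2"
  using binary_pinsker_nonneg[of e] binary_pinsker_nonneg[of "-e"] assms
  by (cases "e \<ge> 0") auto

text \<open>The chain rule for the mutual information of the sequence and \<open>\<zeta>\<close>, which is at most
  the logarithm of the number of values of \<open>\<zeta>\<close>; the size of the fibre of \<open>(take j, \<zeta>)\<close> telescopes.\<close>

lemma sum_power2_predicted_bits:
  fixes \<zeta> :: "int list \<Rightarrow> 'z"
  shows "(\<Sum>j<n. \<Sum>x\<in>streams n. (fibre_avg (streams n) (\<lambda>y. (take j y, \<zeta> y)) (coord j) x)\<^sup>2)
    \<le> 2 * 2 ^ n * ln (real (card (\<zeta> ` streams n)))"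
proof -
  define A where "A = streams n"
  have finA: "finite A" by (simp add: A_def)
  define e where "e j = fibre_avg A (\<lambda>y. (take j y, \<zeta> y)) (coord j)" for j
  define C where "C j x = {y\<in>A. (take j y, \<zeta> y) = (take j x, \<zeta> x)}" for j x
  define c where "c j x = real (card (C j x))" for j x
  have finC: "finite (C j x)" for j x using finA by (simp add: C_def)
  have c_pos: "c j x > 0" if "x \<in> A" for j x
    using that finC[of j x] by (auto simp: c_def card_gt_0_iff C_def)
  \<comment> \<open>Among the sequences sharing the prefix and the value of \<open>\<zeta>\<close>,
    the fraction whose next bit agrees with that of \<open>x\<close> is
    \<open>(1 + coord j x * e j x) / 2\<close>.\<close>
  have step: "2 * c (Suc j) x = c j x * (1 + coord j x * e j x)" if x: "x \<in> A" and j: "j < n" for j x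
  proof -
    have sub: "C (Suc j) x = {y \<in> C j x. y ! j = x ! j}"
      using x j by (auto simp: C_def A_def streams_def take_Suc_conv_app_nth)
    have ind: "(if y ! j = x ! j then 1 else 0) = (1 + coord j x * coord j y) / (2::real)" if "y \<in> C j x" for y
      using coord_cases[of x n j] coord_cases[of y n j] x j that by (auto simp: C_def A_def)
    have "c (Suc j) x = (\<Sum>y\<in>C j x. if y ! j = x ! j then 1 else 0)"
      unfolding c_def sub using finC[of j x] by (simp add: sum.If_cases Int_def)
    also have "\<dots> = (\<Sum>y\<in>C j x. (1 + coord j x * coord j y) / 2)"
      using ind by (rule sum.cong[OF refl])
    also have "\<dots> = (c j x + coord j x * (\<Sum>y\<in>C j x. coord j y)) / 2"
      by (simp add: sum.distrib c_def sum_distrib_left add_divide_distrib flip: sum_divide_distrib)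
    also have "(\<Sum>y\<in>C j x. coord j y) = c j x * e j x"
      using c_pos[OF x, of j] by (simp add: e_def fibre_avg_def c_def C_def)
    finally show ?thesis by (simp add: algebra_simps)
  qed
  have e_le: "\<bar>e j x\<bar> \<le> 1" if x: "x \<in> A" and j: "j < n" for j x
  proof -
    have "\<bar>\<Sum>y\<in>C j x. coord j y\<bar> \<le> (\<Sum>y\<in>C j x. 1)"
      by (rule order_trans[OF sum_abs], rule sum_mono)
        (use coord_cases j in \<open>force simp: C_def A_def\<close>)
    then have "\<bar>\<Sum>y\<in>C j x. coord j y\<bar> \<le> c j x" by (simp add: c_def)
    then show ?thesis using c_pos[OF x, of j]
      by (simp add: e_def fibre_avg_def c_def C_def)
  qed
  have level: "(\<Sum>x\<in>A. (e j x)\<^sup>2) \<le> 2 * (\<Sum>x\<in>A. ln 2 + ln (c (Suc j) x) - ln (c j x))" if j: "j < n" for j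
  proof -
    \<comment> \<open>\<open>u\<close> and \<open>v\<close> are the even and odd parts of
      \<open>ln (1 + t)\<close>. They make the logarithm affine in the sign
      \<open>coord j x\<close>, so the sign can be replaced by its conditional mean
      \<open>e j x\<close>; twice the result is the left side of Pinsker's inequality.\<close>
    define u where "u t = (ln (1 + t) + ln (1 - t)) / 2" for t :: real
    define v where "v t = (ln (1 + t) - ln (1 - t)) / 2" for t :: real
    have ln_eq: "ln 2 + ln (c (Suc j) x) - ln (c j x) = u (e j x) + v (e j x) * coord j x" if x: "x \<in> A" for x
    proof -
      have "ln 2 + ln (c (Suc j) x) = ln (2 * c (Suc j) x)" using c_pos[OF x, of "Suc j"] by (simp add: ln_mult)
      also have "\<dots> = ln (c j x * (1 + coord j x * e j x))" using step[OF x j] by simp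
      also have "\<dots> = ln (c j x) + ln (1 + coord j x * e j x)"
      proof (rule ln_mult_pos)
        have "c j x * (1 + coord j x * e j x) > 0" using step[OF x j] c_pos[OF x] by (metis mult_pos_pos zero_less_numeral)
        then show "1 + coord j x * e j x > 0" using c_pos[OF x, of j] zero_less_mult_pos by blast
      qed (rule c_pos[OF x])
      also have "ln (1 + coord j x * e j x) = u (e j x) + v (e j x) * coord j x"
        using coord_cases[of x n j] x j by (auto simp: A_def u_def v_def field_simps)
      finally show ?thesis by simp
    qed
    have "(\<Sum>x\<in>A. ln 2 + ln (c (Suc j) x) - ln (c j x)) = (\<Sum>x\<in>A. u (e j x)) + (\<Sum>x\<in>A. v (e j x) * coord j x)"
      using ln_eq by (simp add: sum.distrib)
    also have "(\<Sum>x\<in>A. v (e j x) * coord j x) = (\<Sum>x\<in>A. v (e j x) * e j x)"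
      unfolding e_def
      by (rule sum_mult_fibre_avg[OF finA, symmetric], rule factors_on_comp, rule factors_on_fibre_avg)
    also have "(\<Sum>x\<in>A. u (e j x)) + \<dots> = (\<Sum>x\<in>A. u (e j x) + v (e j x) * e j x)"
      by (simp add: sum.distrib)
    finally have *: "2 * (\<Sum>x\<in>A. ln 2 + ln (c (Suc j) x) - ln (c j x)) = (\<Sum>x\<in>A. 2 * (u (e j x) + v (e j x) * e j x))"
      by (simp add: sum_distrib_left)
    show ?thesis unfolding *
    proof (rule sum_mono)
      fix x assume "x \<in> A"
      then have "(1 + e j x) * ln (1 + e j x) + (1 - e j x) * ln (1 - e j x) \<ge> (e j x)\<^sup>2"
        using e_le j by (intro binary_pinsker) auto
      then show "(e j x)\<^sup>2 \<le> 2 * (u (e j x) + v (e j x) * e j x)"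
        by (simp add: u_def v_def field_simps)
    qed
  qed
  define m where "m = real (card (\<zeta> ` A))"
  have A_ne: "A \<noteq> {}" using card_streams[of n] unfolding A_def by (metis card.empty of_nat_0 power_not_zero zero_neq_numeral)
  have m_pos: "m > 0" using finA A_ne by (simp add: m_def card_gt_0_iff)
  have cn: "c n x = 1" if "x \<in> A" for x
  proof -
    have "C n x = {x}" using that by (auto simp: C_def A_def streams_def)
    then show ?thesis by (simp add: c_def)
  qed
  \<comment> \<open>\<open>ln t \<le> t - 1\<close> is applied to
    \<open>t = 2 ^ n / (m * c 0 x)\<close>, whose average over \<open>x\<close> is 1, so the
    correction vanishes after summation.\<close>
  have bound: "real n * ln 2 - ln (c 0 x) \<le> ln m + (2 ^ n / m * (1 / c 0 x) - 1)" if "x \<in> A" for x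
  proof -
    have c0: "c 0 x > 0" by (rule c_pos[OF that])
    have "real n * ln 2 - ln (c 0 x) = ln m + ln (2 ^ n / (m * c 0 x))"
      using c0 m_pos by (simp add: ln_div ln_mult ln_realpow)
    also have "\<dots> \<le> ln m + (2 ^ n / (m * c 0 x) - 1)"
      using c0 m_pos ln_le_minus_one[of "2 ^ n / (m * c 0 x)"] by simp
    finally show ?thesis by simp
  qed
  have "(\<Sum>j<n. \<Sum>x\<in>A. (e j x)\<^sup>2) \<le> (\<Sum>j<n. 2 * (\<Sum>x\<in>A. ln 2 + ln (c (Suc j) x) - ln (c j x)))"
    using level by (intro sum_mono) auto
  also have "\<dots> = 2 * (\<Sum>x\<in>A. \<Sum>j<n. ln 2 + (ln (c (Suc j) x) - ln (c j x)))"
    by (simp add: sum_distrib_left[symmetric] sum.swap[of _ A] add_diff_eq)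
  also have "\<dots> = 2 * (\<Sum>x\<in>A. real n * ln 2 + (ln (c n x) - ln (c 0 x)))"
    by (simp add: sum.distrib sum_lessThan_telescope[of "\<lambda>j. ln (c j x)" for x])
  also have "\<dots> = 2 * (\<Sum>x\<in>A. real n * ln 2 - ln (c 0 x))"
    using cn by simp
  also have "\<dots> \<le> 2 * (\<Sum>x\<in>A. ln m + (2 ^ n / m * (1 / c 0 x) - 1))"
    using bound by (intro mult_left_mono sum_mono) auto
  also have "\<dots> = 2 * (2 ^ n * ln m + (2 ^ n / m * (\<Sum>x\<in>A. 1 / c 0 x) - 2 ^ n))"
    by (simp add: sum.distrib sum_subtractf sum_distrib_left card_streams A_def)
  also have "(\<Sum>x\<in>A. 1 / c 0 x) = m"
    using sum_inverse_card_fibre[OF finA, of \<zeta>] by (simp add: c_def C_def m_def)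
  also have "2 * (2 ^ n * ln m + (2 ^ n / m * m - 2 ^ n)) = 2 * 2 ^ n * ln m" using m_pos by simp
  finally show ?thesis by (simp only: e_def A_def m_def)
qed

section \<open>Orthogonality of the bits, and elementary inequalities for sums\<close>

lemma coord_orthogonal:
  assumes j: "j < n" and \<phi>: "factors_on (streams n) (take j) \<phi>"
  shows "(\<Sum>x\<in>streams n. \<phi> x * coord j x) = 0"
proof -
  \<comment> \<open>Flipping bit \<open>j\<close> is an involution of \<open>streams n\<close> that
    negates the bit and preserves everything determined by the earlier bits.\<close>
  define flip where "flip x = x[j := - x ! j]" for x :: "int list"
  have flip: "flip x \<in> streams n" "flip (flip x) = x" "coord j (flip x) = - coord j x" "\<phi> (flip x) = \<phi> x"
    if x: "x \<in> streams n" for x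
  proof -
    have len: "length x = n" using x by (simp add: streams_def)
    have "set (flip x) \<subseteq> insert (- x ! j) (set x)" unfolding flip_def by (rule set_update_subset_insert)
    moreover have "x ! j \<in> {-1, 1}" using x j nth_mem[of j x] unfolding streams_def by blast
    ultimately show in_streams: "flip x \<in> streams n" using x by (auto simp: streams_def flip_def)
    show "flip (flip x) = x" "coord j (flip x) = - coord j x" using len j by (simp_all add: flip_def)
    show "\<phi> (flip x) = \<phi> x"
      by (rule factors_onD[OF \<phi> in_streams x]) (simp add: flip_def)
  qed
  have "(\<Sum>x\<in>streams n. \<phi> x * coord j x) = (\<Sum>x\<in>streams n. - (\<phi> x * coord j x))"
    by (rule sum.reindex_bij_witness[of _ flip flip]) (use flip in auto)
  then show ?thesis by (simp add: sum_negf)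
qed

lemma second_moment_window:
  "j + d \<le> n \<Longrightarrow> (\<Sum>x\<in>streams n. (\<Sum>l\<in>{j..<j+d}. coord l x)\<^sup>2) = real d * 2 ^ n"
proof (induction d)
  case (Suc d)
  let ?W = "\<lambda>x. \<Sum>l\<in>{j..<j+d}. coord l x"
  have "factors_on (streams n) (take (j + d)) ?W"
    by (intro factors_onI sum.cong refl) (metis atLeastLessThan_iff nth_take)
  then have 0: "(\<Sum>x\<in>streams n. ?W x * coord (j + d) x) = 0"
    using Suc.prems by (intro coord_orthogonal) auto
  have "(\<Sum>x\<in>streams n. (\<Sum>l\<in>{j..<j+Suc d}. coord l x)\<^sup>2)
      = (\<Sum>x\<in>streams n. (?W x)\<^sup>2 + 2 * (?W x * coord (j + d) x) + 1)"
    using Suc.prems by (intro sum.cong) (auto simp: power2_sum coord_power2)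
  also have "\<dots> = (\<Sum>x\<in>streams n. (?W x)\<^sup>2) + 2 * (\<Sum>x\<in>streams n. ?W x * coord (j + d) x) + 2 ^ n"
    by (simp add: sum.distrib sum_distrib_left card_streams)
  finally show ?case using Suc 0 by (simp add: algebra_simps)
qed simp

text \<open>Exchanging the step and the number of terms turns many short increments into only
  \<open>d\<close> long ones, each controlled by the size of \<open>Q\<close>.\<close>

lemma sum_diff_shift:
  fixes Q :: "nat \<Rightarrow> real"
  shows "(\<Sum>j<m. Q (j + d) - Q j) = (\<Sum>j<d. Q (j + m) - Q j)"
proof -
  have "(\<Sum>j<m. Q (j + d)) + (\<Sum>j<d. Q j) = (\<Sum>j<d. Q (j + m)) + (\<Sum>j<m. Q j)" for m
  proof (induction m)
    case (Suc m)
    have "(\<Sum>j<d. Q (j + m)) + Q (m + d) = Q m + (\<Sum>j<d. Q (j + Suc m))"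
      using sum.lessThan_Suc[of "\<lambda>j. Q (j + m)" d] sum.lessThan_Suc_shift[of "\<lambda>j. Q (j + m)" d]
      by (simp add: add.commute)
    then show ?case using Suc by simp
  qed simp
  then show ?thesis by (simp add: sum_subtractf algebra_simps)
qed

lemma sum_shift_le:
  fixes g :: "nat \<Rightarrow> real"
  assumes "\<And>l. 0 \<le> g l"
  shows "(\<Sum>j<n. if j + r < n then g (j + r) else 0) \<le> (\<Sum>l<n. g l)"
proof -
  have "(\<Sum>j<n. if j + r < n then g (j + r) else 0) = (\<Sum>j\<in>{j\<in>{..<n}. j + r < n}. g (j + r))"
    by (rule sum.inter_filter[symmetric]) simp
  also have "\<dots> = (\<Sum>l\<in>(\<lambda>j. j + r) ` {j\<in>{..<n}. j + r < n}. g l)"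
    by (subst sum.reindex) (auto simp: inj_on_def)
  also have "\<dots> \<le> (\<Sum>l<n. g l)" using assms by (intro sum_mono2) auto
  finally show ?thesis .
qed

text \<open>The weighted inequality of arithmetic and geometric means. The free weight
  \<open>t\<close> lets Cauchy--Schwarz be used termwise, without square roots of sums.\<close>

lemma neg_mult_le_weighted:
  fixes x y t :: real
  assumes "t > 0"
  shows "- (x * y) \<le> (t * x\<^sup>2 + y\<^sup>2 / t) / 2"
proof -
  have "0 \<le> (t * x + y)\<^sup>2 / t" using assms by simp
  also have "\<dots> = t * x\<^sup>2 + y\<^sup>2 / t + 2 * (x * y)"
    using assms by (simp add: power2_eq_square field_simps)
  finally show ?thesis by simp
qed

section \<open>Partitions of sign sequences into rectangles\<close>

text \<open>The axiom \<open>glue\<close> says that the fibres of \<open>Z i\<close> are combinatorial rectangles.\<close>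

locale rectangle_partitions =
  fixes n :: nat and \<tau> :: "int list \<Rightarrow> 't" and Z :: "nat \<Rightarrow> int list \<Rightarrow> 'z" and M :: nat
  assumes \<tau>_factors: "i \<le> n \<Longrightarrow> factors_on (streams n) (Z i) \<tau>"
    and glue: "\<lbrakk>i \<le> n; x \<in> streams n; x' \<in> streams n; y \<in> streams n; Z i x = Z i x';
        \<tau> y = \<tau> x; take i y = take i x\<rbrakk> \<Longrightarrow> \<tau> (take i x' @ drop i y) = \<tau> x"
    and card_\<tau>: "card (\<tau> ` streams n) \<le> M"
    and card_Z: "i \<le> n \<Longrightarrow> card (Z i ` streams n) \<le> M"
begin

section \<open>Doob decomposition of the bits in a filtration that knows \<open>\<tau>\<close> from
  the start\<close>

definition F :: "nat \<Rightarrow> int list \<Rightarrow> int list \<times> 't" where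
  "F j = (\<lambda>x. (take j x, \<tau> x))"

text \<open>The predictable drift for the filtration \<open>F\<close>; \<open>\<xi>\<close> is the
  corresponding martingale difference.\<close>

definition b :: "nat \<Rightarrow> int list \<Rightarrow> real" where
  "b j = fibre_avg (streams n) (F j) (coord j)"

definition \<xi> :: "nat \<Rightarrow> int list \<Rightarrow> real" where
  "\<xi> j x = coord j x - b j x"

definition total :: "int list \<Rightarrow> real" where
  "total x = (\<Sum>l<n. coord l x)"

definition tail :: "nat \<Rightarrow> int list \<Rightarrow> real" where
  "tail i x = (\<Sum>l\<in>{i..<n}. coord l x)"

definition a :: "nat \<Rightarrow> int list \<Rightarrow> real" where
  "a i = fibre_avg (streams n) (F i) (tail i)"

text \<open>The Doob martingale of the total. It differs from the expected future \<open>a\<close>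
  by the bits already read.\<close>

definition H :: "nat \<Rightarrow> int list \<Rightarrow> real" where
  "H i = fibre_avg (streams n) (F i) total"

definition \<beta> :: real where
  "\<beta> = (\<Sum>j<n. \<Sum>x\<in>streams n. (b j x)\<^sup>2)"

definition e :: "nat \<Rightarrow> nat \<Rightarrow> int list \<Rightarrow> real" where
  "e j i = fibre_avg (streams n) (\<lambda>x. (take j x, Z i x)) (coord j)"

text \<open>The squared predictability of a bit from its past and the memory \<open>d\<close> steps
  after the start of that bit. The range consists of the \<open>j\<close> with
  \<open>j + d \<le> n\<close>.\<close>

definition \<epsilon> :: "nat \<Rightarrow> real" where
  "\<epsilon> d = (\<Sum>j<n + 1 - d. \<Sum>x\<in>streams n. (e j (j + d) x)\<^sup>2)"

lemma F_mono: "i \<le> j \<Longrightarrow> factors_on (streams n) (F j) (F i)"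
  unfolding F_def by (rule factors_onI) (metis Pair_inject min.absorb1 take_take)

lemma coord_F: "l < j \<Longrightarrow> factors_on (streams n) (F j) (coord l)"
  unfolding F_def by (rule factors_onI) (metis Pair_inject nth_take)

lemma b_F: "j \<le> i \<Longrightarrow> factors_on (streams n) (F i) (b j)"
  unfolding b_def by (rule factors_on_trans[OF F_mono factors_on_fibre_avg])

lemma \<xi>_F: "j < i \<Longrightarrow> factors_on (streams n) (F i) (\<xi> j)"
  unfolding \<xi>_def[abs_def] by (intro factors_on_comp2[of _ _ _ _ "(-)"] coord_F b_F) auto

lemma \<xi>_orthogonal:
  "factors_on (streams n) (F j) \<phi> \<Longrightarrow> (\<Sum>x\<in>streams n. \<phi> x * \<xi> j x) = 0"
  using sum_mult_fibre_avg[of "streams n" "F j" \<phi> "coord j"]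
  by (simp add: \<xi>_def b_def right_diff_distrib sum_subtractf)

lemma card_\<tau>_positive: "1 \<le> card (\<tau> ` streams n)"
proof -
  have "streams n \<noteq> {}" using card_streams[of n] by force
  then show ?thesis by (simp add: Suc_le_eq card_gt_0_iff)
qed

text \<open>The drift comes only from knowing \<open>\<tau>\<close>, so its total energy is bounded
  by the information in \<open>\<tau>\<close>.\<close>

lemma \<beta>_le: "\<beta> \<le> 2 * 2 ^ n * ln (real M)"
proof -
  have "\<beta> \<le> 2 * 2 ^ n * ln (real (card (\<tau> ` streams n)))"
    unfolding \<beta>_def b_def F_def by (rule sum_power2_predicted_bits)
  also have "\<dots> \<le> 2 * 2 ^ n * ln (real M)"
    using card_\<tau> card_\<tau>_positive by (intro mult_left_mono) auto
  finally show ?thesis .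
qed

lemma sum_coord_\<xi>:
  "j < n \<Longrightarrow> (\<Sum>x\<in>streams n. coord j x * \<xi> j x) = 2 ^ n - (\<Sum>x\<in>streams n. (b j x)\<^sup>2)"
proof -
  assume j: "j < n"
  have "(\<Sum>x\<in>streams n. coord j x * \<xi> j x) = (\<Sum>x\<in>streams n. 1 - b j x * coord j x)"
    using coord_power2 j by (intro sum.cong) (auto simp: \<xi>_def right_diff_distrib power2_eq_square)
  also have "\<dots> = 2 ^ n - (\<Sum>x\<in>streams n. b j x * coord j x)"
    by (simp add: sum_subtractf card_streams)
  also have "(\<Sum>x\<in>streams n. b j x * coord j x) = (\<Sum>x\<in>streams n. (b j x)\<^sup>2)"
    using sum_mult_fibre_avg[OF finite_streams factors_on_fibre_avg, of n "F j" "coord j" "coord j"]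
    by (simp add: b_def power2_eq_square)
  finally show ?thesis .
qed

lemma sum_\<xi>_power2_le: "j < n \<Longrightarrow> (\<Sum>x\<in>streams n. (\<xi> j x)\<^sup>2) \<le> 2 ^ n"
proof -
  assume j: "j < n"
  have "(\<Sum>x\<in>streams n. (\<xi> j x)\<^sup>2) = (\<Sum>x\<in>streams n. coord j x * \<xi> j x) - (\<Sum>x\<in>streams n. b j x * \<xi> j x)"
    by (simp add: power2_eq_square \<xi>_def left_diff_distrib sum_subtractf)
  also have "(\<Sum>x\<in>streams n. b j x * \<xi> j x) = 0" by (rule \<xi>_orthogonal) (simp add: b_F)
  also have "(\<Sum>x\<in>streams n. coord j x * \<xi> j x) - 0 \<le> 2 ^ n"
    using j by (simp add: sum_coord_\<xi> sum_nonneg)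
  finally show ?thesis .
qed

text \<open>The increments of a martingale are orthogonal, so their second moments add up.\<close>

lemma sum_martingale_power2_le:
  "m \<le> n \<Longrightarrow> (\<Sum>x\<in>streams n. (\<Sum>j<m. \<xi> j x)\<^sup>2) \<le> real m * 2 ^ n"
proof (induction m)
  case (Suc m)
  have "factors_on (streams n) (F m) (\<lambda>x. \<Sum>j<m. \<xi> j x)"
    by (rule factors_on_sum) (simp add: \<xi>_F)
  then have "(\<Sum>x\<in>streams n. (\<Sum>j<m. \<xi> j x) * \<xi> m x) = 0" by (rule \<xi>_orthogonal)
  then have "(\<Sum>x\<in>streams n. (\<Sum>j<Suc m. \<xi> j x)\<^sup>2)
      = (\<Sum>x\<in>streams n. (\<Sum>j<m. \<xi> j x)\<^sup>2) + (\<Sum>x\<in>streams n. (\<xi> m x)\<^sup>2)"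
    by (simp add: power2_sum sum.distrib mult.assoc flip: sum_distrib_left)
  also have "\<dots> \<le> real m * 2 ^ n + 2 ^ n"
    using Suc by (intro add_mono sum_\<xi>_power2_le) auto
  finally show ?case by (simp add: algebra_simps)
qed simp

lemma sum_total_power2: "(\<Sum>x\<in>streams n. (total x)\<^sup>2) = real n * 2 ^ n"
  using second_moment_window[of 0 n n] by (simp add: total_def lessThan_atLeast0)

text \<open>If \<open>\<tau>\<close> determines a function correlated with the total, then part of the variance of the total is
  explained by \<open>\<tau>\<close>, so the martingale \<open>\<Sum>j. \<xi> j\<close> of full variance has to anticorrelate with the
  drift.\<close>

lemma drift_anticorrelation:
  assumes f: "factors_on (streams n) \<tau> f" "\<And>x. x \<in> streams n \<Longrightarrow> \<bar>f x\<bar> \<le> 1"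
    and adv: "(\<Sum>x\<in>streams n. total x * f x) \<ge> sqrt n / 2 * 2 ^ n"
    and n: "n \<ge> 1"
  shows "- (\<Sum>j<n. \<Sum>x\<in>streams n. \<xi> j x * tail (Suc j) x) \<ge> real n / 8 * 2 ^ n - \<beta>"
proof -
  define G where "G = fibre_avg (streams n) \<tau> total"
  define N where "N x = (\<Sum>j<n. \<xi> j x)" for x
  have G_F: "factors_on (streams n) (F j) G" for j
  proof -
    have "factors_on (streams n) (F j) \<tau>" by (rule factors_onI) (simp add: F_def)
    then show ?thesis unfolding G_def by (rule factors_on_trans[OF _ factors_on_fibre_avg])
  qed
  have r: "sqrt n > 0" "sqrt n * sqrt n = real n" using n by auto
  have GG: "(\<Sum>x\<in>streams n. G x * total x) = (\<Sum>x\<in>streams n. (G x)\<^sup>2)"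
    using sum_mult_fibre_avg[OF finite_streams factors_on_fibre_avg, of n \<tau> total total]
    by (simp add: G_def power2_eq_square)
  \<comment> \<open>Since \<open>f\<close> is determined by \<open>\<tau>\<close>, it sees the total
    only through \<open>G\<close>. With weight \<open>sqrt n / 2\<close> and
    \<open>\<bar>f x\<bar> \<le> 1\<close>, half of the correlation is absorbed, and the other half
    forces \<open>G\<close> to have mean square at least \<open>n / 4\<close>.\<close>
  have "sqrt n / 2 * 2 ^ n \<le> (\<Sum>x\<in>streams n. f x * G x)"
    using adv sum_mult_fibre_avg[OF finite_streams f(1), of total] by (simp add: G_def mult.commute)
  also have "\<dots> \<le> (\<Sum>x\<in>streams n. (G x)\<^sup>2 / sqrt n + sqrt n / 4)"
  proof (rule sum_mono)
    fix x assume x: "x \<in> streams n"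
    have "- ((- f x) * G x) \<le> (sqrt n / 2 * (- f x)\<^sup>2 + (G x)\<^sup>2 / (sqrt n / 2)) / 2"
      using r by (intro neg_mult_le_weighted) auto
    also have "\<dots> = sqrt n / 4 * (f x)\<^sup>2 + (G x)\<^sup>2 / sqrt n" by simp
    also have "\<dots> \<le> sqrt n / 4 * 1 + (G x)\<^sup>2 / sqrt n"
      using f(2)[OF x] by (intro add_right_mono mult_left_mono) (auto simp: abs_square_le_1)
    finally show "f x * G x \<le> (G x)\<^sup>2 / sqrt n + sqrt n / 4" by simp
  qed
  also have "\<dots> = (\<Sum>x\<in>streams n. (G x)\<^sup>2) / sqrt n + sqrt n / 4 * 2 ^ n"
    by (simp add: sum.distrib sum_divide_distrib card_streams)
  finally have "sqrt n / 4 * 2 ^ n \<le> (\<Sum>x\<in>streams n. (G x)\<^sup>2) / sqrt n" by linarith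
  then have "sqrt n * (sqrt n / 4 * 2 ^ n) \<le> sqrt n * ((\<Sum>x\<in>streams n. (G x)\<^sup>2) / sqrt n)"
    using r by (intro mult_left_mono) auto
  then have G_ge: "real n / 4 * 2 ^ n \<le> (\<Sum>x\<in>streams n. (G x)\<^sup>2)"
    using r by (simp add: mult.assoc[symmetric])
  have GN: "(\<Sum>x\<in>streams n. G x * N x) = 0"
  proof -
    have "(\<Sum>x\<in>streams n. G x * N x) = (\<Sum>j<n. \<Sum>x\<in>streams n. G x * \<xi> j x)"
      unfolding N_def sum_distrib_left by (rule sum.swap)
    then show ?thesis using \<xi>_orthogonal[OF G_F] by simp
  qed
  \<comment> \<open>The martingale is orthogonal to \<open>G\<close>, so it can correlate only with
    the unexplained part of the total, of mean square at most \<open>3 * n / 4\<close>. This caps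
    the mean correlation at \<open>(3/4 + 1) * n / 2 = 7 * n / 8\<close>.\<close>
  have "(\<Sum>x\<in>streams n. total x * N x) = (\<Sum>x\<in>streams n. (total x - G x) * N x)"
    using GN by (simp add: left_diff_distrib sum_subtractf)
  also have "\<dots> \<le> (\<Sum>x\<in>streams n. ((total x - G x)\<^sup>2 + (N x)\<^sup>2) / 2)"
  proof (rule sum_mono)
    fix x
    show "(total x - G x) * N x \<le> ((total x - G x)\<^sup>2 + (N x)\<^sup>2) / 2"
      using neg_mult_le_weighted[of 1 "G x - total x" "N x"]
      by (simp add: power2_commute[of "G x"] algebra_simps)
  qed
  also have "\<dots> = ((\<Sum>x\<in>streams n. (total x)\<^sup>2) - (\<Sum>x\<in>streams n. (G x)\<^sup>2) + (\<Sum>x\<in>streams n. (N x)\<^sup>2)) / 2"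
  proof -
    have "(\<Sum>x\<in>streams n. (total x - G x)\<^sup>2) = (\<Sum>x\<in>streams n. (total x)\<^sup>2 + (G x)\<^sup>2 - 2 * (G x * total x))"
      by (rule sum.cong) (auto simp: power2_diff)
    also have "\<dots> = (\<Sum>x\<in>streams n. (total x)\<^sup>2) + (\<Sum>x\<in>streams n. (G x)\<^sup>2) - 2 * (\<Sum>x\<in>streams n. G x * total x)"
      by (simp add: sum.distrib sum_subtractf sum_distrib_left)
    finally show ?thesis using GG by (simp add: sum.distrib sum_divide_distrib[symmetric])
  qed
  also have "\<dots> \<le> (real n * 2 ^ n - real n / 4 * 2 ^ n + real n * 2 ^ n) / 2"
    using G_ge sum_martingale_power2_le[of n] by (simp add: sum_total_power2 N_def)
  finally have upper: "(\<Sum>x\<in>streams n. total x * N x) \<le> 7 / 8 * real n * 2 ^ n" by simp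
  \<comment> \<open>The total is split at bit \<open>j\<close>: the past is orthogonal to
    \<open>\<xi> j\<close>, the bit itself gives almost full variance, and the future must supply
    the deficit.\<close>
  have per_bit: "(\<Sum>x\<in>streams n. total x * \<xi> j x)
      = 2 ^ n - (\<Sum>x\<in>streams n. (b j x)\<^sup>2) + (\<Sum>x\<in>streams n. \<xi> j x * tail (Suc j) x)" if j: "j < n" for j
  proof -
    have split: "total x = (\<Sum>l<j. coord l x) + coord j x + tail (Suc j) x" for x
    proof -
      have "total x = (\<Sum>l<Suc j. coord l x) + tail (Suc j) x"
        unfolding total_def tail_def lessThan_atLeast0
        using j by (intro sum.atLeastLessThan_concat[symmetric]) auto
      then show ?thesis by simp
    qed
    have "factors_on (streams n) (F j) (\<lambda>x. \<Sum>l<j. coord l x)"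
      by (rule factors_on_sum) (simp add: coord_F)
    from \<xi>_orthogonal[OF this] show ?thesis
      by (simp add: split distrib_right sum.distrib sum_coord_\<xi>[OF j] mult.commute[of "tail _ _"])
  qed
  have "(\<Sum>x\<in>streams n. total x * N x) = (\<Sum>j<n. \<Sum>x\<in>streams n. total x * \<xi> j x)"
    unfolding N_def sum_distrib_left by (rule sum.swap)
  also have "\<dots> = real n * 2 ^ n - \<beta> + (\<Sum>j<n. \<Sum>x\<in>streams n. \<xi> j x * tail (Suc j) x)"
    by (simp add: per_bit sum.distrib sum_subtractf \<beta>_def)
  finally show ?thesis using upper by simp
qed

section \<open>The expected future and its variation over a window\<close>

lemma a_factors_Z: "i \<le> n \<Longrightarrow> factors_on (streams n) (Z i) (a i)"
proof (rule factors_onI)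
  fix x x' assume i: "i \<le> n" and x: "x \<in> streams n" "x' \<in> streams n" and Z: "Z i x = Z i x'"
  have \<tau>: "\<tau> x = \<tau> x'" using \<tau>_factors[OF i] x Z by (rule factors_onD)
  define C where "C x = {y\<in>streams n. F i y = F i x}" for x
  \<comment> \<open>Replacing the first \<open>i\<close> bits by those of \<open>x'\<close> maps the
    \<open>F i\<close> fibre of \<open>x\<close> bijectively onto that of \<open>x'\<close>:
    \<open>glue\<close> keeps \<open>\<tau>\<close> fixed, and the tail is untouched.\<close>
  define swap where "swap z y = take i z @ drop i y" for z y :: "int list"
  have len: "length z = n" if "z \<in> streams n" for z using that by (simp add: streams_def)
  have swap: "swap z' y \<in> C z'" "swap z (swap z' y) = y" "tail i (swap z' y) = tail i y"
    if z: "z \<in> streams n" "z' \<in> streams n" and Zz: "Z i z = Z i z'" and y: "y \<in> C z" for z z' y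
  proof -
    have y': "y \<in> streams n" "take i y = take i z" "\<tau> y = \<tau> z" using y by (auto simp: C_def F_def)
    have "\<tau> z = \<tau> z'" using \<tau>_factors[OF i] z Zz by (rule factors_onD)
    moreover have "\<tau> (swap z' y) = \<tau> z" unfolding swap_def using glue[OF i z y'(1) Zz] y' by simp
    moreover have "swap z' y \<in> streams n" unfolding swap_def using z y' by (intro streams_append)
    ultimately show "swap z' y \<in> C z'" using len z i by (simp add: C_def F_def swap_def min_def)
    show "swap z (swap z' y) = y" using len[OF z(2)] i y'(2)
      by (simp add: swap_def min_def) (metis append_take_drop_id)
    show "tail i (swap z' y) = tail i y" unfolding tail_def
      using len[OF z(2)] len[OF y'(1)] i by (intro sum.cong) (auto simp: swap_def nth_append)
  qed
  have sum_eq: "(\<Sum>y\<in>C x. g (tail i y)) = (\<Sum>y\<in>C x'. g (tail i y))" for g :: "real \<Rightarrow> real"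
    by (rule sum.reindex_bij_witness[of _ "swap x" "swap x'"]) (use swap x Z in auto)
  \<comment> \<open>The identity gives equal sums of the tails, the constant 1 equal sizes of the
    fibres.\<close>
  from sum_eq[of "\<lambda>t. t"] sum_eq[of "\<lambda>t. 1"] show "a i x = a i x'"
    by (simp add: a_def fibre_avg_def C_def)
qed

lemma a_eq: "x \<in> streams n \<Longrightarrow> i \<le> n \<Longrightarrow> a i x = H i x - (\<Sum>l<i. coord l x)"
proof -
  assume x: "x \<in> streams n" and i: "i \<le> n"
  have "total = (\<lambda>x. (\<Sum>l<i. coord l x) + tail i x)"
    unfolding total_def tail_def lessThan_atLeast0
    using i by (intro ext sum.atLeastLessThan_concat[symmetric]) auto
  then have "H i x = fibre_avg (streams n) (F i) (\<lambda>x. \<Sum>l<i. coord l x) x + a i x"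
    by (simp add: H_def a_def fibre_avg_add)
  also have "fibre_avg (streams n) (F i) (\<lambda>x. \<Sum>l<i. coord l x) x = (\<Sum>l<i. coord l x)"
    using x by (intro fibre_avg_ident factors_on_sum) (auto simp: coord_F)
  finally show ?thesis by simp
qed

text \<open>Pythagoras for the martingale \<open>H\<close>: its value at time \<open>i\<close> is
  the projection of its value at time \<open>j\<close>.\<close>

lemma sum_H_diff_power2:
  assumes "i \<le> j"
  shows "(\<Sum>x\<in>streams n. (H j x - H i x)\<^sup>2)
    = (\<Sum>x\<in>streams n. (H j x)\<^sup>2) - (\<Sum>x\<in>streams n. (H i x)\<^sup>2)"
proof -
  have Hi: "factors_on (streams n) (F i) (H i)" by (simp add: H_def factors_on_fibre_avg)
  have "(\<Sum>x\<in>streams n. H i x * H j x) = (\<Sum>x\<in>streams n. H i x * total x)"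
    unfolding H_def[of j] by (intro sum_mult_fibre_avg factors_on_trans[OF F_mono[OF assms] Hi]) simp
  also have "\<dots> = (\<Sum>x\<in>streams n. H i x * H i x)"
    using sum_mult_fibre_avg[OF finite_streams Hi, of total] by (simp add: H_def)
  finally have *: "(\<Sum>x\<in>streams n. H i x * H j x) = (\<Sum>x\<in>streams n. (H i x)\<^sup>2)"
    by (simp add: power2_eq_square)
  have "(\<Sum>x\<in>streams n. (H j x - H i x)\<^sup>2) = (\<Sum>x\<in>streams n. (H j x)\<^sup>2 + (H i x)\<^sup>2 - 2 * (H i x * H j x))"
    by (rule sum.cong) (auto simp: power2_diff)
  also have "\<dots> = (\<Sum>x\<in>streams n. (H j x)\<^sup>2) + (\<Sum>x\<in>streams n. (H i x)\<^sup>2) - 2 * (\<Sum>x\<in>streams n. H i x * H j x)"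
    by (simp add: sum.distrib sum_subtractf sum_distrib_left)
  finally show ?thesis using * by simp
qed

text \<open>A change of \<open>a\<close> is an increment of \<open>H\<close> minus the sum of the
  \<open>d\<close> bits in the window. A single increment of \<open>H\<close> may be large, but by
  Pythagoras and \<open>sum_diff_shift\<close> the squares over all windows sum to at most
  \<open>d\<close> times the second moment of the total. Each part contributes half of the factor
  4.\<close>

lemma sum_a_diff_power2_le:
  assumes d: "1 \<le> d" "d \<le> n"
  shows "(\<Sum>j<n + 1 - d. \<Sum>x\<in>streams n. (a (j + d) x - a j x)\<^sup>2) \<le> 4 * real d * real n * 2 ^ n"
proof -
  define Q where "Q j = (\<Sum>x\<in>streams n. (H j x)\<^sup>2)" for j
  have Q: "0 \<le> Q j" "Q j \<le> real n * 2 ^ n" for j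
    using fibre_avg_power2_le[of "streams n" "F j" total]
    by (auto simp: Q_def H_def sum_total_power2 intro: sum_nonneg)
  have one: "(\<Sum>x\<in>streams n. (a (j + d) x - a j x)\<^sup>2) \<le> 2 * (Q (j + d) - Q j) + 2 * (real d * 2 ^ n)"
    if j: "j < n + 1 - d" for j
  proof -
    have jd: "j + d \<le> n" using j d by simp
    let ?W = "\<lambda>x. \<Sum>l\<in>{j..<j+d}. coord l x"
    have "a (j + d) x - a j x = (H (j + d) x - H j x) - ?W x" if "x \<in> streams n" for x
    proof -
      have "(\<Sum>l<j + d. coord l x) = (\<Sum>l<j. coord l x) + ?W x"
        unfolding lessThan_atLeast0 by (intro sum.atLeastLessThan_concat[symmetric]) auto
      then show ?thesis using that jd by (simp add: a_eq)
    qed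
    then have "(\<Sum>x\<in>streams n. (a (j + d) x - a j x)\<^sup>2) = (\<Sum>x\<in>streams n. ((H (j + d) x - H j x) - ?W x)\<^sup>2)"
      by simp
    also have "\<dots> \<le> (\<Sum>x\<in>streams n. 2 * (H (j + d) x - H j x)\<^sup>2 + 2 * (?W x)\<^sup>2)"
    proof (rule sum_mono)
      fix x
      have "0 \<le> ((H (j + d) x - H j x) + ?W x)\<^sup>2" by simp
      then show "((H (j + d) x - H j x) - ?W x)\<^sup>2 \<le> 2 * (H (j + d) x - H j x)\<^sup>2 + 2 * (?W x)\<^sup>2"
        unfolding power2_sum power2_diff[of "H (j + d) x - H j x" "?W x"] by linarith
    qed
    also have "\<dots> = 2 * (\<Sum>x\<in>streams n. (H (j + d) x - H j x)\<^sup>2) + 2 * (\<Sum>x\<in>streams n. (?W x)\<^sup>2)"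
      by (simp add: sum.distrib sum_distrib_left)
    finally show ?thesis by (simp add: sum_H_diff_power2 second_moment_window[OF jd] Q_def)
  qed
  have "(\<Sum>j<n + 1 - d. \<Sum>x\<in>streams n. (a (j + d) x - a j x)\<^sup>2)
      \<le> (\<Sum>j<n + 1 - d. 2 * (Q (j + d) - Q j) + 2 * (real d * 2 ^ n))"
    using one by (intro sum_mono) auto
  also have "\<dots> = 2 * (\<Sum>j<n + 1 - d. Q (j + d) - Q j) + real (n + 1 - d) * (2 * (real d * 2 ^ n))"
    by (simp add: sum.distrib sum_distrib_left)
  also have "(\<Sum>j<n + 1 - d. Q (j + d) - Q j) \<le> (\<Sum>j<d. real n * 2 ^ n)"
  proof (subst sum_diff_shift, rule sum_mono)
    fix j show "Q (j + (n + 1 - d)) - Q j \<le> real n * 2 ^ n"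
      using Q(1)[of j] Q(2)[of "j + (n + 1 - d)"] by linarith
  qed
  also have "real (n + 1 - d) * (2 * (real d * 2 ^ n)) \<le> real n * (2 * (real d * 2 ^ n))"
    using d by (intro mult_right_mono) auto
  finally show ?thesis by (simp add: algebra_simps)
qed

section \<open>Correlation of a martingale difference with later bits\<close>

lemma far_correlation:
  assumes d: "1 \<le> d" "j + d \<le> n" and t: "t > 0"
  shows "- (\<Sum>x\<in>streams n. \<xi> j x * tail (j + d) x)
    \<le> (t * (\<Sum>x\<in>streams n. (e j (j + d) x)\<^sup>2) + (\<Sum>x\<in>streams n. (a (j + d) x - a j x)\<^sup>2) / t) / 2"
proof -
  define \<kappa> where "\<kappa> = (\<lambda>x. (take j x, Z (j + d) x))"
  define D where "D x = a (j + d) x - a j x" for x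
  let ?e = "e j (j + d)"
  have e_eq: "?e = fibre_avg (streams n) \<kappa> (coord j)" by (simp add: e_def \<kappa>_def)
  have \<kappa>_F: "factors_on (streams n) \<kappa> (F j)"
    using \<tau>_factors[OF d(2)] by (intro factors_onI) (auto simp: \<kappa>_def F_def dest: factors_onD)
  have aj: "factors_on (streams n) (F j) (a j)" by (simp add: a_def factors_on_fibre_avg)
  have \<kappa>_b: "factors_on (streams n) \<kappa> (b j)" by (rule factors_on_trans[OF \<kappa>_F b_F]) simp
  have \<kappa>_D: "factors_on (streams n) \<kappa> D"
    unfolding D_def[abs_def]
  proof (rule factors_on_comp2[of _ _ _ _ "(-)"])
    have "factors_on (streams n) \<kappa> (Z (j + d))" by (rule factors_onI) (simp add: \<kappa>_def)
    then show "factors_on (streams n) \<kappa> (a (j + d))" by (rule factors_on_trans[OF _ a_factors_Z[OF d(2)]])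
    show "factors_on (streams n) \<kappa> (a j)" by (rule factors_on_trans[OF \<kappa>_F aj])
  qed
  \<comment> \<open>The tail is replaced by its conditional mean \<open>a (j + d)\<close>, and
    \<open>a j\<close> is subtracted for free because it is orthogonal to \<open>\<xi> j\<close>.
    The rectangle property makes the difference \<open>D\<close> a function of
    \<open>\<kappa>\<close>, so the bit in turn may be replaced by its prediction
    \<open>e j (j + d)\<close>.\<close>
  have "(\<Sum>x\<in>streams n. \<xi> j x * tail (j + d) x) = (\<Sum>x\<in>streams n. \<xi> j x * a (j + d) x)"
    using d unfolding a_def by (intro sum_mult_fibre_avg[symmetric] \<xi>_F) auto
  also have "\<dots> = (\<Sum>x\<in>streams n. \<xi> j x * D x)"
    using \<xi>_orthogonal[OF aj] by (simp add: D_def right_diff_distrib sum_subtractf mult.commute)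
  also have "\<dots> = (\<Sum>x\<in>streams n. D x * coord j x) - (\<Sum>x\<in>streams n. D x * b j x)"
    by (simp add: \<xi>_def algebra_simps sum_subtractf)
  also have "(\<Sum>x\<in>streams n. D x * coord j x) = (\<Sum>x\<in>streams n. D x * ?e x)"
    unfolding e_eq by (rule sum_mult_fibre_avg[symmetric, OF finite_streams \<kappa>_D])
  finally have "- (\<Sum>x\<in>streams n. \<xi> j x * tail (j + d) x) = (\<Sum>x\<in>streams n. - ((?e x - b j x) * D x))"
    by (simp add: sum_negf algebra_simps sum_subtractf)
  also have "\<dots> \<le> (\<Sum>x\<in>streams n. (t * (?e x - b j x)\<^sup>2 + (D x)\<^sup>2 / t) / 2)"
    using t by (intro sum_mono neg_mult_le_weighted)
  also have "\<dots> = (t * (\<Sum>x\<in>streams n. (?e x - b j x)\<^sup>2) + (\<Sum>x\<in>streams n. (D x)\<^sup>2) / t) / 2"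
    by (simp add: sum.distrib sum_distrib_left sum_divide_distrib add_divide_distrib)
  \<comment> \<open>As \<open>\<kappa>\<close> determines \<open>F j\<close>, the drift
    \<open>b j\<close> is the projection of the prediction, and removing it only decreases the mean
    square.\<close>
  also have "(\<Sum>x\<in>streams n. (?e x - b j x)\<^sup>2) \<le> (\<Sum>x\<in>streams n. (?e x)\<^sup>2)"
  proof -
    have "(\<Sum>x\<in>streams n. b j x * ?e x) = (\<Sum>x\<in>streams n. b j x * coord j x)"
      unfolding e_eq by (rule sum_mult_fibre_avg[OF finite_streams \<kappa>_b])
    also have "\<dots> = (\<Sum>x\<in>streams n. b j x * b j x)"
      using sum_mult_fibre_avg[OF finite_streams b_F[OF order_refl, of j], of "coord j"] by (simp add: b_def)
    finally have *: "(\<Sum>x\<in>streams n. b j x * ?e x) = (\<Sum>x\<in>streams n. (b j x)\<^sup>2)"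
      by (simp add: power2_eq_square)
    have "(\<Sum>x\<in>streams n. (?e x - b j x)\<^sup>2) = (\<Sum>x\<in>streams n. (?e x)\<^sup>2 + (b j x)\<^sup>2 - 2 * (b j x * ?e x))"
      by (rule sum.cong) (auto simp: power2_diff)
    also have "\<dots> = (\<Sum>x\<in>streams n. (?e x)\<^sup>2) + (\<Sum>x\<in>streams n. (b j x)\<^sup>2) - 2 * (\<Sum>x\<in>streams n. b j x * ?e x)"
      by (simp add: sum.distrib sum_subtractf sum_distrib_left)
    finally show ?thesis using * by (simp add: sum_nonneg)
  qed
  finally show ?thesis using t by (simp add: D_def)
qed

text \<open>A later bit correlates with \<open>\<xi> j\<close> only through its own drift, because
  \<open>F (j + r)\<close> already determines \<open>\<xi> j\<close>.\<close>

lemma near_correlation: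
  assumes "1 \<le> r" "j + r < n" and t: "t > 0"
  shows "- (\<Sum>x\<in>streams n. \<xi> j x * coord (j + r) x) \<le> (t * (\<Sum>x\<in>streams n. (b (j + r) x)\<^sup>2) + 2 ^ n / t) / 2"
proof -
  have "(\<Sum>x\<in>streams n. \<xi> j x * coord (j + r) x) = (\<Sum>x\<in>streams n. \<xi> j x * b (j + r) x)"
    using assms unfolding b_def by (intro sum_mult_fibre_avg[symmetric] \<xi>_F) auto
  then have "- (\<Sum>x\<in>streams n. \<xi> j x * coord (j + r) x) = (\<Sum>x\<in>streams n. - (b (j + r) x * \<xi> j x))"
    by (simp add: sum_negf mult.commute)
  also have "\<dots> \<le> (\<Sum>x\<in>streams n. (t * (b (j + r) x)\<^sup>2 + (\<xi> j x)\<^sup>2 / t) / 2)"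
    using t by (intro sum_mono neg_mult_le_weighted)
  also have "\<dots> = (t * (\<Sum>x\<in>streams n. (b (j + r) x)\<^sup>2) + (\<Sum>x\<in>streams n. (\<xi> j x)\<^sup>2) / t) / 2"
    by (simp add: sum.distrib sum_distrib_left sum_divide_distrib add_divide_distrib)
  also have "\<dots> \<le> (t * (\<Sum>x\<in>streams n. (b (j + r) x)\<^sup>2) + 2 ^ n / t) / 2"
    using t assms by (intro divide_right_mono add_left_mono sum_\<xi>_power2_le) auto
  finally show ?thesis .
qed

lemma tail_split:
  "1 \<le> d \<Longrightarrow> tail (Suc j) x = (\<Sum>r\<in>{1..<d}. if j + r < n then coord (j + r) x else 0) + tail (j + d) x"
proof (induction d rule: dec_induct)
  case (step d)
  have "tail (j + d) x = (if j + d < n then coord (j + d) x else 0) + tail (j + Suc d) x"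
    by (auto simp: tail_def sum.atLeast_Suc_lessThan)
  then show ?case using step by simp
qed simp

lemma sum_tail_le:
  assumes d: "1 \<le> d" "d \<le> n"
  shows "- (\<Sum>j<n. \<Sum>x\<in>streams n. \<xi> j x * tail (Suc j) x)
    \<le> 16 * (real d)\<^sup>2 * \<beta> + 32 * (real d * \<epsilon> d) + 3 / 64 * real n * 2 ^ n"
proof -
  define near where "near r j = (if j + r < n then - (\<Sum>x\<in>streams n. \<xi> j x * coord (j + r) x) else 0)" for r j
  define far where "far j = - (\<Sum>x\<in>streams n. \<xi> j x * tail (j + d) x)" for j
  have split: "- (\<Sum>x\<in>streams n. \<xi> j x * tail (Suc j) x) = (\<Sum>r\<in>{1..<d}. near r j) + far j" for j
  proof -
    have "(\<Sum>x\<in>streams n. \<xi> j x * tail (Suc j) x)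
      = (\<Sum>x\<in>streams n. \<Sum>r\<in>{1..<d}. \<xi> j x * (if j + r < n then coord (j + r) x else 0))
        + (\<Sum>x\<in>streams n. \<xi> j x * tail (j + d) x)"
      unfolding tail_split[OF d(1)] by (simp add: distrib_left sum.distrib sum_distrib_left)
    also have "(\<Sum>x\<in>streams n. \<Sum>r\<in>{1..<d}. \<xi> j x * (if j + r < n then coord (j + r) x else 0))
      = (\<Sum>r\<in>{1..<d}. - near r j)"
      by (subst sum.swap) (auto simp: near_def intro!: sum.cong)
    finally show ?thesis by (simp add: far_def sum_negf)
  qed
  \<comment> \<open>These weights make the terms free of \<open>\<beta>\<close> and
    \<open>\<epsilon>\<close> equal to \<open>1/64\<close> (near, over at most \<open>d\<close>
    values of \<open>r\<close>) and \<open>4/128 = 1/32\<close> (far) of \<open>n * 2 ^ n\<close>.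
    Together they stay below the \<open>1/8\<close> of \<open>drift_anticorrelation\<close>.\<close>
  let ?\<mu> = "32 * real d" and ?t = "64 * real d"
  have near_r: "(\<Sum>j<n. near r j) \<le> (?\<mu> * \<beta> + real n * 2 ^ n / ?\<mu>) / 2" if r: "r \<in> {1..<d}" for r
  proof -
    have "(\<Sum>j<n. near r j) \<le> (\<Sum>j<n. (?\<mu> * (if j + r < n then \<Sum>x\<in>streams n. (b (j + r) x)\<^sup>2 else 0) + 2 ^ n / ?\<mu>) / 2)"
    proof (rule sum_mono)
      fix j
      have "- (\<Sum>x\<in>streams n. \<xi> j x * coord (j + r) x)
          \<le> (?\<mu> * (\<Sum>x\<in>streams n. (b (j + r) x)\<^sup>2) + 2 ^ n / ?\<mu>) / 2" if "j + r < n"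
        using that r d by (intro near_correlation) auto
      then show "near r j \<le> (?\<mu> * (if j + r < n then \<Sum>x\<in>streams n. (b (j + r) x)\<^sup>2 else 0)
          + 2 ^ n / ?\<mu>) / 2"
        by (simp add: near_def)
    qed
    also have "\<dots> = (?\<mu> * (\<Sum>j<n. if j + r < n then \<Sum>x\<in>streams n. (b (j + r) x)\<^sup>2 else 0) + real n * 2 ^ n / ?\<mu>) / 2"
      by (simp add: sum.distrib sum_distrib_left sum_divide_distrib add_divide_distrib)
    also have "\<dots> \<le> (?\<mu> * \<beta> + real n * 2 ^ n / ?\<mu>) / 2"
      unfolding \<beta>_def by (intro divide_right_mono add_right_mono mult_left_mono sum_shift_le) (auto intro: sum_nonneg)
    finally show ?thesis .
  qed
  have \<beta>_nonneg: "0 \<le> \<beta>" unfolding \<beta>_def by (intro sum_nonneg) auto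
  have near_total: "(\<Sum>r\<in>{1..<d}. \<Sum>j<n. near r j) \<le> 16 * (real d)\<^sup>2 * \<beta> + 1 / 64 * real n * 2 ^ n"
  proof -
    have "(\<Sum>r\<in>{1..<d}. \<Sum>j<n. near r j) \<le> real (d - 1) * ((?\<mu> * \<beta> + real n * 2 ^ n / ?\<mu>) / 2)"
      using sum_mono[of "{1..<d}", OF near_r] by (simp only: sum_constant card_atLeastLessThan)
    also have "\<dots> \<le> real d * ((?\<mu> * \<beta> + real n * 2 ^ n / ?\<mu>) / 2)"
      using \<beta>_nonneg by (intro mult_right_mono) auto
    also have "\<dots> = 16 * (real d)\<^sup>2 * \<beta> + 1 / 64 * real n * 2 ^ n"
      using d by (simp add: field_simps power2_eq_square)
    finally show ?thesis .
  qed
  have far_total: "(\<Sum>j<n. far j) \<le> 32 * (real d * \<epsilon> d) + 1 / 32 * real n * 2 ^ n"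
  proof -
    \<comment> \<open>For the remaining \<open>j\<close> the window passes the end, and the tail is
      an empty sum.\<close>
    have "(\<Sum>j<n. far j) = (\<Sum>j<n + 1 - d. far j)"
    proof (rule sum.mono_neutral_right)
      show "\<forall>j\<in>{..<n} - {..<n + 1 - d}. far j = 0" using d by (auto simp: far_def tail_def)
    qed (use d in auto)
    also have "\<dots> \<le> (\<Sum>j<n + 1 - d. (?t * (\<Sum>x\<in>streams n. (e j (j + d) x)\<^sup>2)
        + (\<Sum>x\<in>streams n. (a (j + d) x - a j x)\<^sup>2) / ?t) / 2)"
      unfolding far_def using d by (intro sum_mono far_correlation) auto
    also have "\<dots> = (?t * \<epsilon> d + (\<Sum>j<n + 1 - d. \<Sum>x\<in>streams n. (a (j + d) x - a j x)\<^sup>2) / ?t) / 2"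
      unfolding \<epsilon>_def by (simp only: sum.distrib sum_distrib_left sum_divide_distrib add_divide_distrib)
    also have "\<dots> \<le> (?t * \<epsilon> d + (4 * real d * real n * 2 ^ n) / ?t) / 2"
      using d by (intro divide_right_mono add_left_mono sum_a_diff_power2_le) auto
    also have "\<dots> = 32 * (real d * \<epsilon> d) + 1 / 32 * real n * 2 ^ n"
      using d by (simp add: field_simps)
    finally show ?thesis .
  qed
  have "- (\<Sum>j<n. \<Sum>x\<in>streams n. \<xi> j x * tail (Suc j) x) = (\<Sum>j<n. (\<Sum>r\<in>{1..<d}. near r j) + far j)"
    by (simp only: split flip: sum_negf[of _ "{..<n}"])
  also have "\<dots> = (\<Sum>r\<in>{1..<d}. \<Sum>j<n. near r j) + (\<Sum>j<n. far j)"
    unfolding sum.distrib by (subst sum.swap) (rule refl)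
  finally have "- (\<Sum>j<n. \<Sum>x\<in>streams n. \<xi> j x * tail (Suc j) x)
      = (\<Sum>r\<in>{1..<d}. \<Sum>j<n. near r j) + (\<Sum>j<n. far j)" .
  then show ?thesis using near_total far_total by simp
qed

section \<open>Choosing the window length\<close>

lemma sum_\<epsilon>_le: "(\<Sum>d\<in>{1..D}. \<epsilon> d) \<le> 2 * real n * 2 ^ n * ln (real M)"
proof -
  define g where "g j i = (\<Sum>x\<in>streams n. (e j i x)\<^sup>2)" for j i
  have g_nonneg: "0 \<le> g j i" for j i unfolding g_def by (intro sum_nonneg) auto
  let ?P = "SIGMA d:{1..D}. {..<n + 1 - d}"
  \<comment> \<open>Pairs are regrouped by the time \<open>i = j + d\<close>. For fixed
    \<open>i\<close>, the prediction bound with side information \<open>Z i\<close> covers all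
    \<open>j\<close> at once.\<close>
  let ?h = "\<lambda>(d, j). (j + d, j) :: nat \<times> nat"
  have "(\<Sum>d\<in>{1..D}. \<epsilon> d) = (\<Sum>(d, j)\<in>?P. g j (j + d))"
    unfolding \<epsilon>_def g_def by (subst sum.Sigma) auto
  also have "\<dots> = (\<Sum>(i, j)\<in>?h ` ?P. g j i)"
    by (subst sum.reindex) (auto simp: inj_on_def intro!: sum.cong)
  also have "\<dots> \<le> (\<Sum>(i, j)\<in>(SIGMA i:{1..n}. {..<n}). g j i)"
    using g_nonneg by (intro sum_mono2) auto
  also have "\<dots> = (\<Sum>i\<in>{1..n}. \<Sum>j<n. g j i)" by (subst sum.Sigma) auto
  also have "\<dots> \<le> (\<Sum>i\<in>{1..n}. 2 * 2 ^ n * ln (real M))"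
  proof (rule sum_mono)
    fix i assume i: "i \<in> {1..n}"
    have "(\<Sum>j<n. g j i) \<le> 2 * 2 ^ n * ln (real (card (Z i ` streams n)))"
      unfolding g_def e_def by (rule sum_power2_predicted_bits)
    also have "\<dots> \<le> 2 * 2 ^ n * ln (real M)"
    proof -
      have "streams n \<noteq> {}" using card_streams[of n] by force
      then have "0 < card (Z i ` streams n)" by (simp add: card_gt_0_iff)
      then show ?thesis using card_Z[of i] i by (intro mult_left_mono) auto
    qed
    finally show "(\<Sum>j<n. g j i) \<le> 2 * 2 ^ n * ln (real M)" .
  qed
  finally show ?thesis by (simp add: algebra_simps)
qed

theorem ln_card_ge:
  assumes f: "factors_on (streams n) \<tau> f" "\<And>x. x \<in> streams n \<Longrightarrow> \<bar>f x\<bar> \<le> 1"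
    and adv: "(\<Sum>x\<in>streams n. total x * f x) \<ge> sqrt n / 2 * 2 ^ n"
    and n: "n \<ge> 2"
  shows "ln (real M) \<ge> ln (real n) / 5000"
proof (rule ccontr)
  assume "\<not> ?thesis"
  then have M: "ln (real M) < ln (real n) / 5000" by simp
  have ln_n: "ln (real n) > 0" using n by simp
  \<comment> \<open>The exponent \<open>1/4\<close> keeps the harmonic sum up to \<open>D\<close> at
    least \<open>ln n / 4\<close>, while \<open>d^2 \<le> sqrt n\<close> makes the near term
    \<open>d^2 * \<beta>\<close>, of order \<open>sqrt n * ln n\<close>, affordable.\<close>
  define q where "q = real n powr (1 / 4)"
  define D where "D = nat \<lfloor>q\<rfloor>"
  have q: "1 \<le> q" "q\<^sup>2 = sqrt n" "ln q = ln (real n) / 4"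
    using n by (auto simp: q_def ge_one_powr_ge_zero ln_powr powr_powr powr_half_sqrt simp flip: powr_numeral)
  have D: "1 \<le> D" "real D \<le> q" "q \<le> real D + 1"
    using q(1) by (auto simp: D_def le_nat_floor)
  have sqrt_n: "1 \<le> sqrt n" "sqrt n * sqrt n = real n" using n by auto
  have "q * 1 \<le> q * q" using q by (intro mult_left_mono) auto
  also have "\<dots> = sqrt n * 1" using q by (simp add: power2_eq_square)
  also have "\<dots> \<le> sqrt n * sqrt n" using sqrt_n by (intro mult_left_mono) auto
  finally have "q \<le> real n" using sqrt_n by simp
  then have D_le: "D \<le> n" using D by linarith
  \<comment> \<open>Otherwise every \<open>\<epsilon> d\<close> exceeds a multiple of
    \<open>1 / d\<close>, and the harmonic sum contradicts \<open>sum_\<epsilon>_le\<close>. The 8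
    is the 2 of that lemma times the 4 lost to the fourth root.\<close>
  have "\<exists>d\<in>{1..D}. real d * \<epsilon> d \<le> 8 / 5000 * real n * 2 ^ n"
  proof (rule ccontr)
    assume no_d: "\<not> ?thesis"
    have big: "8 / 5000 * real n * 2 ^ n * inverse (real d) \<le> \<epsilon> d" if d: "d \<in> {1..D}" for d
    proof -
      have "8 / 5000 * real n * 2 ^ n < real d * \<epsilon> d" using no_d d by (meson not_le)
      then show ?thesis using d by (simp add: field_simps)
    qed
    have "ln (real n) / 4 \<le> ln (real D + 1)"
      unfolding q(3)[symmetric] using D q by (intro ln_mono) auto
    also have "\<dots> \<le> harm D" using ln_le_harm[of D] by (simp add: add.commute)
    finally have "8 / 5000 * real n * 2 ^ n * (ln (real n) / 4) \<le> 8 / 5000 * real n * 2 ^ n * harm D"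
      by (intro mult_left_mono) auto
    also have "\<dots> \<le> (\<Sum>d\<in>{1..D}. \<epsilon> d)"
      unfolding harm_def sum_distrib_left using big by (intro sum_mono) auto
    also have "\<dots> \<le> 2 * real n * 2 ^ n * ln (real M)" by (rule sum_\<epsilon>_le)
    also have "\<dots> < 2 * real n * 2 ^ n * (ln (real n) / 5000)"
      using M n by (intro mult_strict_left_mono) auto
    finally show False by simp
  qed
  then obtain d where d: "1 \<le> d" "d \<le> D" and eps: "real d * \<epsilon> d \<le> 8 / 5000 * real n * 2 ^ n" by auto
  have \<beta>: "\<beta> \<le> 2 * 2 ^ n * (ln (real n) / 5000)"
    by (rule order_trans[OF \<beta>_le]) (use M in simp)
  have ln_sqrt: "ln (real n) \<le> 2 * sqrt n"
    using ln_le_minus_one[of "sqrt n"] n by (simp add: ln_sqrt)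
  have \<beta>1: "\<beta> \<le> 2 / 5000 * real n * 2 ^ n"
  proof -
    have "2 * 2 ^ n * (ln (real n) / 5000) \<le> 2 * 2 ^ n * (real n / 5000)"
      using ln_le_minus_one[of "real n"] n by (intro mult_left_mono divide_right_mono) auto
    also have "\<dots> = 2 / 5000 * real n * 2 ^ n" by simp
    finally show ?thesis using \<beta> by (rule order_trans[rotated])
  qed
  have "(real d)\<^sup>2 \<le> q\<^sup>2" using d D q by (intro power_mono) auto
  then have d2: "(real d)\<^sup>2 \<le> sqrt n" using q by simp
  have "(real d)\<^sup>2 * \<beta> \<le> sqrt n * (2 * 2 ^ n * (2 * sqrt n / 5000))"
  proof (rule mult_mono[OF d2])
    show "\<beta> \<le> 2 * 2 ^ n * (2 * sqrt n / 5000)"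
      by (rule order_trans[OF \<beta>]) (use ln_sqrt in simp)
    show "0 \<le> \<beta>" unfolding \<beta>_def by (intro sum_nonneg) auto
  qed auto
  also have "\<dots> = 4 / 5000 * (sqrt n * sqrt n) * 2 ^ n" by simp
  finally have \<beta>2: "(real d)\<^sup>2 * \<beta> \<le> 4 / 5000 * real n * 2 ^ n" using sqrt_n by simp
  have "real n / 8 * 2 ^ n - \<beta> \<le> 16 * ((real d)\<^sup>2 * \<beta>) + 32 * (real d * \<epsilon> d) + 3 / 64 * real n * 2 ^ n"
    using drift_anticorrelation[OF f adv] sum_tail_le[of d] d D_le n by simp
  \<comment> \<open>The bracket collects \<open>\<beta>\<close>, 16 times
    \<open>d^2 * \<beta>\<close>, 32 times \<open>d * \<epsilon> d\<close>, and the fixed error. It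
    is about 0.111, below \<open>1/8\<close>.\<close>
  then have "real n / 8 * 2 ^ n \<le> (2 / 5000 + 64 / 5000 + 256 / 5000 + 3 / 64) * (real n * 2 ^ n)"
    using \<beta>1 \<beta>2 eps by (simp add: algebra_simps)
  moreover have "0 < real n * 2 ^ n" using n by simp
  ultimately show False by (simp add: field_simps)
qed

end

section \<open>Multi-pass algorithms\<close>

lemma run_pass_append:
  "run_pass \<delta> \<rho> j i st (xs @ ys) = run_pass \<delta> \<rho> j (i + length xs) (run_pass \<delta> \<rho> j i st xs) ys"
  by (induction xs arbitrary: i st) auto

lemma run_pass_bounded:
  assumes "memory_bounded init \<delta> s k n" "j < k"
  shows "st < 2 ^ s \<Longrightarrow> i + length xs \<le> n \<Longrightarrow> set xs \<subseteq> {-1, 1} \<Longrightarrow> run_pass \<delta> \<rho> j i st xs < 2 ^ s"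
proof (induction xs arbitrary: i st)
  case (Cons x xs)
  have "\<delta> \<rho> j i st x < 2 ^ s"
    using assms Cons.prems unfolding memory_bounded_def by auto
  then show ?case using Cons by simp
qed simp

lemma run_passes_bounded:
  assumes "memory_bounded init \<delta> s k n" "xs \<in> streams n"
  shows "m \<le> k \<Longrightarrow> run_passes \<delta> \<rho> m (init \<rho>) xs < 2 ^ s"
proof (induction m)
  case 0
  then show ?case using assms by (simp add: memory_bounded_def)
next
  case (Suc m)
  then show ?case using assms by (auto simp: streams_def intro!: run_pass_bounded)
qed

definition end_states ::
  "(nat \<Rightarrow> nat \<Rightarrow> nat \<Rightarrow> nat \<Rightarrow> int \<Rightarrow> nat) \<Rightarrow> nat \<Rightarrow> nat \<Rightarrow> nat \<Rightarrow> int list \<Rightarrow> nat list" where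
  "end_states \<delta> \<rho> k st xs = map (\<lambda>j. run_passes \<delta> \<rho> (Suc j) st xs) [0..<k]"

definition mid_states ::
  "(nat \<Rightarrow> nat \<Rightarrow> nat \<Rightarrow> nat \<Rightarrow> int \<Rightarrow> nat) \<Rightarrow> nat \<Rightarrow> nat \<Rightarrow> nat \<Rightarrow> nat \<Rightarrow> int list \<Rightarrow> nat list" where
  "mid_states \<delta> \<rho> k st i xs = map (\<lambda>j. run_pass \<delta> \<rho> j 0 (run_passes \<delta> \<rho> j st xs) (take i xs)) [0..<k]"

lemma end_states_eqD:
  assumes "end_states \<delta> \<rho> k st xs = end_states \<delta> \<rho> k st ys" "m \<le> k"
  shows "run_passes \<delta> \<rho> m st xs = run_passes \<delta> \<rho> m st ys"
proof (cases m)
  case (Suc j)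
  then have "end_states \<delta> \<rho> k st zs ! j = run_passes \<delta> \<rho> m st zs" for zs
    using assms(2) by (simp add: end_states_def del: run_passes.simps)
  then show ?thesis using assms(1) by metis
qed simp

lemma mid_states_eqD:
  assumes "mid_states \<delta> \<rho> k st i xs = mid_states \<delta> \<rho> k st i ys" "j < k"
  shows "run_pass \<delta> \<rho> j 0 (run_passes \<delta> \<rho> j st xs) (take i xs)
    = run_pass \<delta> \<rho> j 0 (run_passes \<delta> \<rho> j st ys) (take i ys)"
proof -
  have "mid_states \<delta> \<rho> k st i zs ! j = run_pass \<delta> \<rho> j 0 (run_passes \<delta> \<rho> j st zs) (take i zs)" for zs
    using assms(2) by (simp add: mid_states_def)
  then show ?thesis using assms(1) by metis
qed

text \<open>Cut and paste over the passes: on the hybrid input each pass starts as on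
  \<open>x\<close>, reaches at position \<open>i\<close> the state common to \<open>x'\<close>,
  \<open>x\<close> and \<open>y\<close>, and then follows \<open>y\<close> to an end state shared
  with \<open>x\<close>.\<close>

lemma run_passes_glue:
  assumes len: "length x = length y" "length x' = length y"
    and ends: "end_states \<delta> \<rho> k st x = end_states \<delta> \<rho> k st x'" "end_states \<delta> \<rho> k st y = end_states \<delta> \<rho> k st x"
    and mids: "mid_states \<delta> \<rho> k st i x = mid_states \<delta> \<rho> k st i x'"
    and pre: "take i y = take i x"
  shows "m \<le> k \<Longrightarrow> run_passes \<delta> \<rho> m st (take i x' @ drop i y) = run_passes \<delta> \<rho> m st x"
proof (induction m)
  case (Suc m)
  then have m: "m < k" by simp
  have "run_passes \<delta> \<rho> (Suc m) st (take i x' @ drop i y)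
      = run_pass \<delta> \<rho> m (length (take i x')) (run_pass \<delta> \<rho> m 0 (run_passes \<delta> \<rho> m st x) (take i x')) (drop i y)"
    using Suc by (simp add: run_pass_append)
  also have "run_passes \<delta> \<rho> m st x = run_passes \<delta> \<rho> m st x'"
    by (rule end_states_eqD[OF ends(1)]) (use m in simp)
  also have "run_pass \<delta> \<rho> m 0 (run_passes \<delta> \<rho> m st x') (take i x')
      = run_pass \<delta> \<rho> m 0 (run_passes \<delta> \<rho> m st x) (take i x)"
    by (rule mid_states_eqD[OF mids m, symmetric])
  also have "\<dots> = run_pass \<delta> \<rho> m 0 (run_passes \<delta> \<rho> m st y) (take i y)"
    using end_states_eqD[OF ends(2), of m] m by (simp add: pre)
  also have "length (take i x') = length (take i y)" using len by simp
  also have "run_pass \<delta> \<rho> m (length (take i y)) (run_pass \<delta> \<rho> m 0 (run_passes \<delta> \<rho> m st y) (take i y)) (drop i y)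
      = run_pass \<delta> \<rho> m 0 (run_passes \<delta> \<rho> m st y) (take i y @ drop i y)"
    by (simp only: run_pass_append) simp
  also have "\<dots> = run_passes \<delta> \<rho> (Suc m) st y" by simp
  also have "\<dots> = run_passes \<delta> \<rho> (Suc m) st x" by (rule end_states_eqD[OF ends(2) Suc.prems])
  finally show ?case .
qed simp

text \<open>The end states and the mid states each take \<open>s * k\<close> bits, whence the
  exponent. Keeping the end states inside \<open>Z\<close> makes it determine
  \<open>\<tau>\<close>.\<close>

lemma rectangle_partitions_run_passes:
  assumes mem: "memory_bounded init \<delta> s k n"
  shows "rectangle_partitions n (end_states \<delta> \<rho> k (init \<rho>))
    (\<lambda>i x. (end_states \<delta> \<rho> k (init \<rho>) x, mid_states \<delta> \<rho> k (init \<rho>) i x)) (2 ^ (2 * (s * k)))"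
proof
  let ?E = "end_states \<delta> \<rho> k (init \<rho>)" and ?Mid = "mid_states \<delta> \<rho> k (init \<rho>)"
  let ?L = "{xs. set xs \<subseteq> {..<2 ^ s :: nat} \<and> length xs = k}"
  have L: "finite ?L" "card ?L = 2 ^ (s * k)"
    by (simp_all add: finite_lists_length_eq card_lists_length_eq power_mult)
  have E: "?E x \<in> ?L" if "x \<in> streams n" for x
    using run_passes_bounded[OF mem that] by (auto simp: end_states_def simp del: run_passes.simps)
  have Mid: "?Mid i x \<in> ?L" if x: "x \<in> streams n" and i: "i \<le> n" for i x
  proof -
    have "run_pass \<delta> \<rho> j 0 (run_passes \<delta> \<rho> j (init \<rho>) x) (take i x) < 2 ^ s" if j: "j < k" for j
      using x i j run_passes_bounded[OF mem x, of j]
      by (intro run_pass_bounded[OF mem j]) (auto simp: streams_def dest: in_set_takeD)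
    then show ?thesis by (auto simp: mid_states_def)
  qed
  show "card (?E ` streams n) \<le> 2 ^ (2 * (s * k))"
  proof -
    have "card (?E ` streams n) \<le> card ?L" using E L by (intro card_mono) auto
    also have "\<dots> \<le> 2 ^ (2 * (s * k))" unfolding L by (rule power_increasing) auto
    finally show ?thesis .
  qed
  fix i assume i: "i \<le> n"
  show "factors_on (streams n) (\<lambda>x. (?E x, ?Mid i x)) ?E" by (rule factors_onI) simp
  have "card ((\<lambda>x. (?E x, ?Mid i x)) ` streams n) \<le> card (?L \<times> ?L)"
    using E Mid[OF _ i] L(1) by (intro card_mono finite_cartesian_product image_subsetI SigmaI)
  also have "\<dots> = 2 ^ (2 * (s * k))"
    unfolding card_cartesian_product L by (simp add: mult_2 power_add)
  finally show "card ((\<lambda>x. (?E x, ?Mid i x)) ` streams n) \<le> 2 ^ (2 * (s * k))" .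
  fix x x' y assume x: "x \<in> streams n" "x' \<in> streams n" "y \<in> streams n"
    and eq: "(?E x, ?Mid i x) = (?E x', ?Mid i x')" "?E y = ?E x" "take i y = take i x"
  have "run_passes \<delta> \<rho> m (init \<rho>) (take i x' @ drop i y) = run_passes \<delta> \<rho> m (init \<rho>) x" if "m \<le> k" for m
    using x eq that by (intro run_passes_glue[where x' = x' and y = y]) (auto simp: streams_def)
  then show "?E (take i x' @ drop i y) = ?E x"
    by (auto simp: end_states_def simp del: run_passes.simps)
qed

section \<open>From error probability to correlation with the total, and averaging over the
  seed\<close>

lemma deterministic_memory_bound:
  assumes n: "n \<ge> 2" and k: "k \<ge> 1" and mem: "memory_bounded init \<delta> s k n"
    and err: "real (card {x\<in>streams n. out \<rho> (run_passes \<delta> \<rho> k (init \<rho>) x) \<noteq> majority x}) \<le> 2 ^ n / 1600"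
  shows "log 2 (real n) / 10000 \<le> real s * real k"
proof -
  interpret rectangle_partitions n "end_states \<delta> \<rho> k (init \<rho>)"
    "\<lambda>i x. (end_states \<delta> \<rho> k (init \<rho>) x, mid_states \<delta> \<rho> k (init \<rho>) i x)" "2 ^ (2 * (s * k))"
    by (rule rectangle_partitions_run_passes[OF mem])
  define ok where "ok x \<longleftrightarrow> out \<rho> (run_passes \<delta> \<rho> k (init \<rho>) x) = majority x" for x
  \<comment> \<open>Any output other than 1 counts as -1, so \<open>f\<close> is a sign for
    arbitrary outputs.\<close>
  define f :: "int list \<Rightarrow> real" where "f x = (if out \<rho> (run_passes \<delta> \<rho> k (init \<rho>) x) = 1 then 1 else -1)" for x
  have f: "factors_on (streams n) (end_states \<delta> \<rho> k (init \<rho>)) f"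
    by (rule factors_onI) (simp add: f_def end_states_eqD)
  define r where "r = sqrt n"
  have r: "r > 0" "r\<^sup>2 = real n" using n by (auto simp: r_def)
  \<comment> \<open>A wrong answer costs at most \<open>2 * \<bar>total x\<bar>\<close>, bounded by
    a square plus a constant since errors may sit at large totals. With 40 and error rate
    \<open>1/1600\<close> both parts average at most \<open>r / 40\<close>, and
    \<open>5/9 - 1/20 \<ge> 1/2\<close>.\<close>
  have pt: "\<bar>total x\<bar> - (total x)\<^sup>2 / (40 * r) - (if ok x then 0 else 40 * r) \<le> total x * f x"
    if x: "x \<in> streams n" for x
  proof (cases "ok x")
    case True
    then have "total x * f x = \<bar>total x\<bar>"
      using x by (auto simp: ok_def f_def majority_def total_def simp flip: sum_list_coords split: if_splits)
    then show ?thesis using True r by simp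
  next
    case False
    have "2 * \<bar>total x\<bar> \<le> (total x)\<^sup>2 / (40 * r) + 40 * r"
      using neg_mult_le_weighted[of "40 * r" "-1" "\<bar>total x\<bar>"] r by simp
    moreover have "- \<bar>total x\<bar> \<le> total x * f x" by (auto simp: f_def)
    ultimately show ?thesis using False by simp
  qed
  have tot: "(\<Sum>x\<in>streams n. \<bar>total x\<bar>) = (\<Sum>x\<in>streams n. \<bar>real_of_int (sum_list x)\<bar>)"
    by (intro sum.cong) (auto simp: total_def sum_list_coords)
  have "r / 2 * 2 ^ n \<le> 5 / 9 * r * 2 ^ n - (real n * 2 ^ n) / (40 * r) - 40 * r * (2 ^ n / 1600)"
    unfolding r(2)[symmetric] using r by (simp add: power2_eq_square field_simps)
  also have "\<dots> \<le> (\<Sum>x\<in>streams n. \<bar>total x\<bar>) - (\<Sum>x\<in>streams n. (total x)\<^sup>2) / (40 * r)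
      - 40 * r * real (card {x\<in>streams n. \<not> ok x})"
    using first_abs_moment_streams[of n] n r err unfolding tot sum_total_power2
    by (intro diff_mono mult_left_mono) (auto simp: r_def ok_def)
  also have "\<dots> = (\<Sum>x\<in>streams n. \<bar>total x\<bar> - (total x)\<^sup>2 / (40 * r) - (if ok x then 0 else 40 * r))"
  proof -
    have "(\<Sum>x\<in>streams n. if ok x then 0 else 40 * r) = 40 * r * real (card {x\<in>streams n. \<not> ok x})"
      by (simp add: sum.If_cases Int_def)
    then show ?thesis by (simp add: sum_subtractf sum_divide_distrib)
  qed
  also have "\<dots> \<le> (\<Sum>x\<in>streams n. total x * f x)" using pt by (rule sum_mono)
  finally have "ln (real n) / 5000 \<le> ln (real (2 ^ (2 * (s * k))))"
    using n by (intro ln_card_ge[OF f]) (auto simp: f_def r_def)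
  also have "\<dots> = 2 * (real s * real k) * ln 2" by (simp add: ln_realpow)
  finally show ?thesis by (simp add: log_def field_simps)
qed

text \<open>Integrating out the stream first bounds the success for each seed. Contrapositively, a
  successful randomized algorithm has a good fixed seed.\<close>

lemma success_prob_le:
  assumes err: "\<And>\<rho>. real (card {x\<in>streams n. out \<rho> (run_passes \<delta> \<rho> k (init \<rho>) x) \<noteq> majority x}) \<ge> p * 2 ^ n"
    and p: "p \<le> 1"
  shows "success_prob R init \<delta> out k n \<le> 1 - p"
proof -
  define A where "A = {(\<rho>, xs). out \<rho> (run_passes \<delta> \<rho> k (init \<rho>) xs) = majority xs}"
  define U where "U = pmf_of_set (streams n)"
  have ne: "streams n \<noteq> {}" using card_streams[of n] by force
  have inner: "(\<integral>\<^sup>+ x. indicator A (\<rho>, x) \<partial>measure_pmf U) \<le> ennreal (1 - p)" for \<rho>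
  proof -
    let ?G = "{x. (\<rho>, x) \<in> A}"
    have "(\<integral>\<^sup>+ x. indicator A (\<rho>, x) \<partial>measure_pmf U) = (\<integral>\<^sup>+ x. indicator ?G x \<partial>measure_pmf U)"
      by (intro nn_integral_cong) (auto simp: indicator_def)
    also have "\<dots> = ennreal (measure_pmf.prob U ?G)"
      by (simp add: measure_pmf.emeasure_eq_measure)
    also have "measure_pmf.prob U ?G \<le> 1 - p"
    proof -
      let ?B = "{x\<in>streams n. out \<rho> (run_passes \<delta> \<rho> k (init \<rho>) x) \<noteq> majority x}"
      have "streams n \<inter> ?G = streams n - ?B" by (auto simp: A_def)
      then have "real (card (streams n \<inter> ?G)) = real (card (streams n)) - real (card ?B)"
        by (simp add: card_Diff_subset of_nat_diff card_mono)
      also have "\<dots> \<le> (1 - p) * 2 ^ n" using err[of \<rho>] by (simp add: card_streams algebra_simps)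
      finally show ?thesis
        by (simp add: U_def measure_pmf_of_set[OF ne] card_streams divide_le_eq)
    qed
    finally show ?thesis using ennreal_leI by blast
  qed
  have "ennreal (success_prob R init \<delta> out k n) = emeasure (measure_pmf (pair_pmf R U)) A"
    by (simp add: success_prob_def A_def U_def measure_pmf.emeasure_eq_measure)
  also have "\<dots> = (\<integral>\<^sup>+ z. indicator A z \<partial>measure_pmf (pair_pmf R U))" by simp
  also have "\<dots> = (\<integral>\<^sup>+ \<rho>. \<integral>\<^sup>+ x. indicator A (\<rho>, x) \<partial>measure_pmf U \<partial>measure_pmf R)"
    by (rule nn_integral_pair_pmf')
  also have "\<dots> \<le> (\<integral>\<^sup>+ \<rho>. ennreal (1 - p) \<partial>measure_pmf R)"
    using inner by (intro nn_integral_mono) auto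
  also have "\<dots> = ennreal (1 - p)" by simp
  finally show ?thesis using p by (simp add: ennreal_le_iff)
qed

theorem theorem1p2:
  shows "\<exists>\<gamma>::real. \<gamma> > 0 \<and> (\<exists>c::real. c > 0 \<and>
    (\<forall>(n::nat) (k::nat) (s::nat) (R::nat pmf) (init::nat \<Rightarrow> nat)
        (\<delta>::nat \<Rightarrow> nat \<Rightarrow> nat \<Rightarrow> nat \<Rightarrow> int \<Rightarrow> nat) (out::nat \<Rightarrow> nat \<Rightarrow> int).
       n \<ge> 1 \<longrightarrow> k \<ge> 1 \<longrightarrow> memory_bounded init \<delta> s k n \<longrightarrow>
       success_prob R init \<delta> out k n \<ge> 1 - \<gamma> \<longrightarrow>
       real s \<ge> c * log 2 (real n) / real k))"
proof -
  have "real s \<ge> 1 / 10000 * log 2 (real n) / real k"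
    if n: "n \<ge> 1" and k: "k \<ge> 1" and mem: "memory_bounded init \<delta> s k n"
      and succ: "success_prob R init \<delta> out k n \<ge> 1 - 1 / 3200"
    for n k s :: nat and R init \<delta> out
  proof (cases "n = 1")
    case False
    then have n: "n \<ge> 2" using n by simp
    \<comment> \<open>If every seed erred on more than a \<open>1/1600\<close> fraction, success
      would be at most \<open>1 - 1/1600\<close>, strictly below \<open>1 - 1/3200\<close>.\<close>
    have "\<exists>\<rho>. real (card {x\<in>streams n. out \<rho> (run_passes \<delta> \<rho> k (init \<rho>) x) \<noteq> majority x}) \<le> 2 ^ n / 1600"
    proof (rule ccontr)
      assume *: "\<not> ?thesis"
      have "1 / 1600 * 2 ^ n \<le> real (card {x\<in>streams n. out \<rho> (run_passes \<delta> \<rho> k (init \<rho>) x) \<noteq> majority x})" for \<rho>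
        using spec[OF *[unfolded not_ex], of \<rho>] by linarith
      then have "success_prob R init \<delta> out k n \<le> 1 - 1 / 1600" by (rule success_prob_le) simp
      then show False using succ by simp
    qed
    then obtain \<rho> where
      "real (card {x\<in>streams n. out \<rho> (run_passes \<delta> \<rho> k (init \<rho>) x) \<noteq> majority x}) \<le> 2 ^ n / 1600" ..
    then have "log 2 (real n) / 10000 \<le> real s * real k" by (rule deterministic_memory_bound[OF n k mem])
    then show ?thesis using k by (simp add: field_simps)
  qed simp
  then show ?thesis
    by (intro exI[of _ "1 / 3200"] exI[of _ "1 / 10000"] conjI allI impI) auto
qed

end
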